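(* Let $\lambda$ be a regular content on a Hausdorff space $X$. Then the induced map $\tilde p:X^\lambda\rightarrow\mathfrak{Sl}(X)$ identifies $X^\lambda$ with a sublocale of $\mathfrak{Sl}(X)$; that is, $\tilde p$ is an embedding of locales.
   Context: A frame is a poset with arbitrary suprema and finite infima satisfying $V\wedge\bigvee_i U_i=\bigvee_i(V\wedge U_i)$; locales are the objects of the opposite category of frames, $\mathcal{O}(L)$ is the frame of $L$, and a continuous map $f:L\to M$ is a frame homomorphism $f^*:\mathcal{O}(M)\to\mathcal{O}(L)$ with right adjoint $f_*$. It is an embedding if $f^*$ is surjective (equivalently $f_*$ is injective). Hausdorff spaces are identified with the locales of their frames of opens. A locale is Boolean if every open has a complement. A sublocale of $L$ is a subset $S\subset\mathcal{O}(L)$ that is a frame in the induced order and whose inclusion is right adjoint to a frame homomorphism $\mathcal{O}(L)\to S$. The poset $\mathrm{Sl}(L)$ of sublocales ordered by inclusion is a coframe; $\mathfrak{Sl}(L)$ is the locale with frame $\mathrm{Sl}(L)^{op}$. The natural map $\mathrm{can}:\mathfrak{Sl}(L)\to L$ has $\mathrm{can}^*(U)=U^c=\{V\mid U\le V\}$. If $M$ is Boolean, every continuous map $f:M\to L$ has a unique lift $\tilde f:M\to\mathfrak{Sl}(L)$ with $\mathrm{can}\circ\tilde f=f$. $\mathcal{K}(X)$ is the lattice of compact subsets of $X$. A content is a function $\lambda:\mathcal{K}(X)\to[0,+\infty)$ that is monotone, subadditive ($\lambda(C\cup D)\le\lambda(C)+\lambda(D)$), and additive on disjoint pairs. Write $K_1\ll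 K_2$ if there is an open $U$ with $K_1\subset U\subset K_2$. A content is regular if $\lambda(K)=\inf\{\lambda(K')\mid K\ll K',\ K'\text{ compact}\}$ for all compact $K$ (infimum in $[0,+\infty]$). On a Hausdorff space a regular content is modular: $\lambda(C)+\lambda(D)=\lambda(C\cup D)+\lambda(C\cap D)$. A $\lambda$-ideal is a downward closed $U\subset\mathcal{K}(X)$ such that $K\in U$ whenever there are $K_i\in U$ $(i\in I)$, $K_i\subset K$, such that for all $\epsilon>0$ some finite $F\subset I$ has $\lambda(K)-\lambda(\bigcup_{i\in F}K_i)<\epsilon$. The $\lambda$-ideals ordered by inclusion form the frame of a locale $X^\lambda$, which is Boolean. The map $p_\lambda:X^\lambda\to X$ has inverse image sending an open $V\subset X$ to the smallest $\lambda$-ideal containing $\{K\subset V\mid K\text{ compact}\}$, and $\tilde p:X^\lambda\to\mathfrak{Sl}(X)$ is its unique lift along $\mathrm{can}$. *)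

theory Defs
  imports "HOL-Analysis.Analysis" "HOL-Algebra.Galois_Connection"
begin

section \<open>Frames and locales\<close>

text \<open>Frames are carrier-based complete lattices. A locale is represented by its frame of opens.\<close>

locale frame = complete_lattice +
  assumes inf_sup_distrib:
    "\<lbrakk>V \<in> carrier L; A \<subseteq> carrier L\<rbrakk> \<Longrightarrow> V \<sqinter> \<Squnion>A = \<Squnion>((\<lambda>U. V \<sqinter> U) ` A)"

locale frame_hom = A?: frame A + B?: frame B for A (structure) and B (structure) +
  fixes h :: "'a \<Rightarrow> 'b"
  assumes hom_closed: "h \<in> carrier A \<rightarrow> carrier B"
    and hom_sup: "S \<subseteq> carrier A \<Longrightarrow> h (\<Squnion>\<^bsub>A\<^esub>S) = \<Squnion>\<^bsub>B\<^esub>(h ` S)"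
    and hom_top: "h \<top>\<^bsub>A\<^esub> = \<top>\<^bsub>B\<^esub>"
    and hom_inf: "\<lbrakk>x \<in> carrier A; y \<in> carrier A\<rbrakk> \<Longrightarrow> h (x \<sqinter>\<^bsub>A\<^esub> y) = h x \<sqinter>\<^bsub>B\<^esub> h y"

text \<open>
  A continuous map \<open>f : L \<rightarrow> M\<close> is represented by its inverse image map
  \<open>f\<^sup>* : \<O>(M) \<rightarrow> \<O>(L)\<close>, made extensional so that equality of continuous maps is equality
  of HOL functions. Consequently the composite \<open>g \<circ> f\<close> of \<open>f : L \<rightarrow> M\<close> and \<open>g : M \<rightarrow> N\<close> is
  represented by \<open>compose (carrier N) f\<^sup>* g\<^sup>*\<close>.
\<close>

definition locale_maps :: "'a gorder \<Rightarrow> 'b gorder \<Rightarrow> ('b \<Rightarrow> 'a) set" where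
  "locale_maps L M = {f \<in> extensional (carrier M). frame_hom M L f}"

definition locale_embedding :: "'a gorder \<Rightarrow> 'b gorder \<Rightarrow> ('b \<Rightarrow> 'a) \<Rightarrow> bool" where
  "locale_embedding L M f \<longleftrightarrow> f \<in> locale_maps L M \<and> f ` carrier M = carrier L"


section \<open>Sublocales and the locale of sublocales\<close>

definition is_sublocale :: "'a gorder \<Rightarrow> 'a set \<Rightarrow> bool" where
  "is_sublocale L S \<longleftrightarrow>
     S \<subseteq> carrier L \<and> frame (L\<lparr>carrier := S\<rparr>) \<and>
     (\<exists>h. frame_hom L (L\<lparr>carrier := S\<rparr>) h \<and>
          galois_connection
            \<lparr>orderA = L, orderB = L\<lparr>carrier := S\<rparr>, lower = h, upper = (\<lambda>s. s)\<rparr>)"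

definition sublocale_order :: "'a gorder \<Rightarrow> 'a set gorder" where
  "sublocale_order L = \<lparr>carrier = {S. is_sublocale L S}, eq = (=), le = (\<subseteq>)\<rparr>"

definition sublocale_locale :: "'a gorder \<Rightarrow> 'a set gorder" where
  "sublocale_locale L = inv_gorder (sublocale_order L)"

definition can :: "'a gorder \<Rightarrow> 'a \<Rightarrow> 'a set" where
  "can L = (\<lambda>U\<in>carrier L. {V \<in> carrier L. U \<sqsubseteq>\<^bsub>L\<^esub> V})"

text \<open>
  The lift \<open>g\<close> of \<open>f : M \<rightarrow> L\<close> along \<open>can\<close>, determined by \<open>can \<circ> g = f\<close>; it exists and
  is unique for Boolean \<open>M\<close>.
\<close>

definition lift_can :: "'b gorder \<Rightarrow> 'a gorder \<Rightarrow> ('a \<Rightarrow> 'b) \<Rightarrow> ('a set \<Rightarrow> 'b)" where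
  "lift_can M L f =
     (THE g. g \<in> locale_maps M (sublocale_locale L) \<and> compose (carrier L) g (can L) = f)"

definition opens_frame :: "'a topology \<Rightarrow> 'a set gorder" where
  "opens_frame X = \<lparr>carrier = {U. openin X U}, eq = (=), le = (\<subseteq>)\<rparr>"


section \<open>Contents\<close>

text \<open>Only the values of a content on compact sets are meaningful.\<close>

locale compact_content =
  fixes X :: "'a topology" and lam :: "'a set \<Rightarrow> real"
  assumes nonneg: "compactin X C \<Longrightarrow> 0 \<le> lam C"
    and mono: "\<lbrakk>compactin X C; compactin X D; C \<subseteq> D\<rbrakk> \<Longrightarrow> lam C \<le> lam D"
    and subadditive: "\<lbrakk>compactin X C; compactin X D\<rbrakk> \<Longrightarrow> lam (C \<union> D) \<le> lam C + lam D"
    and additive: "\<lbrakk>compactin X C; compactin X D; C \<inter> D = {}\<rbrakk> \<Longrightarrow> lam (C \<union> D) = lam C + lam D"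

definition way_inside :: "'a topology \<Rightarrow> 'a set \<Rightarrow> 'a set \<Rightarrow> bool" where
  "way_inside X K K' \<longleftrightarrow> (\<exists>U. openin X U \<and> K \<subseteq> U \<and> U \<subseteq> K')"

text \<open>The infimum is taken in \<open>[0,\<infinity>]\<close>, where the infimum of the empty set is \<open>\<infinity>\<close>.\<close>

locale regular_content = compact_content +
  assumes regular: "compactin X K \<Longrightarrow>
    ennreal (lam K) = (INF K'\<in>{K'. compactin X K' \<and> way_inside X K K'}. ennreal (lam K'))"


section \<open>The locale of $\lambda$-ideals\<close>

text \<open>
  The family \<open>(K\<^sub>i)\<close> is replaced by its set \<open>\<A>\<close> of members: the condition involves
  only unions of finite subfamilies, which do not see repetitions.
\<close>

definition content_ideal :: "'a topology \<Rightarrow> ('a set \<Rightarrow> real) \<Rightarrow> 'a set set \<Rightarrow> bool" where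
  "content_ideal X lam U \<longleftrightarrow>
     U \<subseteq> {K. compactin X K} \<and>
     (\<forall>K\<in>U. \<forall>C. compactin X C \<and> C \<subseteq> K \<longrightarrow> C \<in> U) \<and>
     (\<forall>K \<A>. compactin X K \<and> \<A> \<subseteq> U \<and> (\<forall>C\<in>\<A>. C \<subseteq> K) \<and>
        (\<forall>\<epsilon>>0. \<exists>\<F>. finite \<F> \<and> \<F> \<subseteq> \<A> \<and> lam K - lam (\<Union>\<F>) < \<epsilon>) \<longrightarrow> K \<in> U)"

definition content_locale :: "'a topology \<Rightarrow> ('a set \<Rightarrow> real) \<Rightarrow> 'a set set gorder" where
  "content_locale X lam = \<lparr>carrier = {U. content_ideal X lam U}, eq = (=), le = (\<subseteq>)\<rparr>"

definition content_proj :: "'a topology \<Rightarrow> ('a set \<Rightarrow> real) \<Rightarrow> 'a set \<Rightarrow> 'a set set" where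
  "content_proj X lam =
     (\<lambda>V\<in>carrier (opens_frame X). content_ideal X lam hull {K. compactin X K \<and> K \<subseteq> V})"

definition content_lift :: "'a topology \<Rightarrow> ('a set \<Rightarrow> real) \<Rightarrow> 'a set set \<Rightarrow> 'a set set" where
  "content_lift X lam = lift_can (content_locale X lam) (opens_frame X) (content_proj X lam)"

end

theory Submission
  imports Defs
begin

text \<open>The frame of sublocales is generated under joins and finite meets by the closed sublocales
\<open>can U\<close> and their complements, the open sublocales. Hence a map from a Boolean locale to it is
determined by its values on the closed ones, its value on an open sublocale being the complement
of that on the corresponding closed one. The lift of \<open>p\<close> therefore takes the values \<open>\<not> p\<^sup>*V\<close> as well as
\<open>p\<^sup>*V\<close>, and it is an embedding as soon as the elements \<open>\<not> p\<^sup>*V\<close> generate all \<open>\<lambda>\<close>-ideals under joins.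

They do. For a compact \<open>K\<close>, the complement of \<open>p\<^sup>*(X - K)\<close> is the \<open>\<lambda>\<close>-ideal generated by \<open>K\<close>: every
compact \<open>C\<close> is approximated by \<open>C \<inter> K\<close> together with the compact remainder that is left when a
neighbourhood of \<open>C \<inter> K\<close> of almost the same content is removed (\<open>compact_complement\<close>). And every
\<open>\<lambda>\<close>-ideal is the join of the \<open>\<lambda>\<close>-ideals generated by its members
(\<open>content_ideal_eq_sup_compacts\<close>).

Most of the work goes into the existence of the lift. A sublocale is a set closed under meets and
under implication from arbitrary elements (\<open>is_sublocale_iff\<close>), which makes the lattice of
sublocales computable and its dual a frame (\<open>frame_sublocale_locale\<close>). The generators force a
formula for the lift, and for a Boolean domain this formula defines a frame homomorphism
(\<open>frame_hom_lift\<close>, \<open>lift_can_eq_lift\<close>). To apply this to \<open>X\<^sup>\<lambda>\<close> one needs that the \<open>\<lambda>\<close>-ideals form a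
Boolean frame. Regularity makes \<open>\<lambda>\<close> modular (\<open>modular\<close>), so that the defect \<open>\<lambda>(K) - \<lambda>(C)\<close> of an
approximation \<open>C \<subseteq> K\<close> behaves like the measure of \<open>K - C\<close>; then the \<open>\<lambda>\<close>-ideal generated by an
ideal of compact sets consists of the sets approximated from inside by members of that ideal
(\<open>hull_eq_approx\<close>), and complements are obtained by exhausting a compact set from inside by members of
a given \<open>\<lambda>\<close>-ideal (\<open>disjoint_ideal_approx_covers\<close>).\<close>

section \<open>Frames\<close>

lemma (in partial_order) sup_eqI:
  assumes "A \<subseteq> carrier L" "s \<in> carrier L" "\<And>x. x \<in> A \<Longrightarrow> x \<sqsubseteq> s"
    and "\<And>y. y \<in> carrier L \<Longrightarrow> (\<And>x. x \<in> A \<Longrightarrow> x \<sqsubseteq> y) \<Longrightarrow> s \<sqsubseteq> y"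
  shows "\<Squnion>A = s"
proof -
  have *: "least L s (Upper L A)"
    using assms by (intro least_UpperI) (auto simp: Upper_def Int_absorb2)
  show ?thesis
    unfolding Lattice.sup_def using least_unique[OF _ *] * by (intro some_equality)
qed

lemma (in partial_order) inf_eqI:
  assumes "A \<subseteq> carrier L" "s \<in> carrier L" "\<And>x. x \<in> A \<Longrightarrow> s \<sqsubseteq> x"
    and "\<And>y. y \<in> carrier L \<Longrightarrow> (\<And>x. x \<in> A \<Longrightarrow> y \<sqsubseteq> x) \<Longrightarrow> y \<sqsubseteq> s"
  shows "\<Sqinter>A = s"
proof -
  have *: "greatest L s (Lower L A)"
    using assms by (intro greatest_LowerI) (auto simp: Lower_def Int_absorb2)
  show ?thesis
    unfolding Lattice.inf_def using greatest_unique[OF _ *] * by (intro some_equality)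
qed

lemma (in partial_order) meet_eqI:
  assumes "x \<in> carrier L" "y \<in> carrier L" "m \<in> carrier L" "m \<sqsubseteq> x" "m \<sqsubseteq> y"
    and "\<And>z. z \<in> carrier L \<Longrightarrow> z \<sqsubseteq> x \<Longrightarrow> z \<sqsubseteq> y \<Longrightarrow> z \<sqsubseteq> m"
  shows "x \<sqinter> y = m"
  unfolding meet_def using assms by (intro inf_eqI) auto

lemma (in partial_order) top_eqI:
  assumes "t \<in> carrier L" "\<And>x. x \<in> carrier L \<Longrightarrow> x \<sqsubseteq> t"
  shows "\<top> = t"
proof -
  have *: "greatest L t (carrier L)"
    using assms by (auto simp: greatest_def)
  show ?thesis
    unfolding Order.top_def using greatest_unique[OF _ *] * by (intro some_equality)
qed

lemma (in partial_order) bottom_eqI: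
  assumes "t \<in> carrier L" "\<And>x. x \<in> carrier L \<Longrightarrow> t \<sqsubseteq> x"
  shows "\<bottom> = t"
proof -
  have *: "least L t (carrier L)"
    using assms by (auto simp: least_def)
  show ?thesis
    unfolding Order.bottom_def using least_unique[OF _ *] * by (intro some_equality)
qed

lemma (in complete_lattice) frameI:
  assumes "\<And>V A. \<lbrakk>V \<in> carrier L; A \<subseteq> carrier L\<rbrakk> \<Longrightarrow> V \<sqinter> \<Squnion>A \<sqsubseteq> \<Squnion>((\<lambda>U. V \<sqinter> U) ` A)"
  shows "frame L"
proof
  fix V A assume V: "V \<in> carrier L" and A: "A \<subseteq> carrier L"
  have sub: "(\<lambda>U. V \<sqinter> U) ` A \<subseteq> carrier L"
    using V A by auto
  have "\<Squnion>((\<lambda>U. V \<sqinter> U) ` A) \<sqsubseteq> V \<sqinter> \<Squnion>A"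
  proof (rule sup_least[OF sub])
    fix x assume "x \<in> (\<lambda>U. V \<sqinter> U) ` A"
    then obtain U where U: "U \<in> A" "x = V \<sqinter> U" by blast
    have "U \<in> carrier L" "U \<sqsubseteq> \<Squnion>A" using U A sup_upper by auto
    then show "x \<sqsubseteq> V \<sqinter> \<Squnion>A"
      using U V A by (metis le_trans meet_closed meet_le meet_left meet_right sup_closed)
  qed (use V A in auto)
  then show "V \<sqinter> \<Squnion>A = \<Squnion>((\<lambda>U. V \<sqinter> U) ` A)"
    using assms[OF V A] V A sub by (intro le_antisym) auto
qed

definition heyting :: "('a, 'b) gorder_scheme \<Rightarrow> 'a \<Rightarrow> 'a \<Rightarrow> 'a" (infixr \<open>\<rightharpoonup>\<index>\<close> 60)
  where "a \<rightharpoonup>\<^bsub>L\<^esub> b = \<Squnion>\<^bsub>L\<^esub>{c \<in> carrier L. c \<sqinter>\<^bsub>L\<^esub> a \<sqsubseteq>\<^bsub>L\<^esub> b}"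

context frame
begin

lemma le_meet_iff:
  assumes "x \<in> carrier L" "y \<in> carrier L" "z \<in> carrier L"
  shows "z \<sqsubseteq> x \<sqinter> y \<longleftrightarrow> z \<sqsubseteq> x \<and> z \<sqsubseteq> y"
  using assms by (meson le_trans meet_closed meet_le meet_left meet_right)

lemma join_le_iff:
  assumes "x \<in> carrier L" "y \<in> carrier L" "z \<in> carrier L"
  shows "x \<squnion> y \<sqsubseteq> z \<longleftrightarrow> x \<sqsubseteq> z \<and> y \<sqsubseteq> z"
  using assms by (meson le_trans join_closed join_le join_left join_right)

lemma meet_mono:
  assumes "x \<in> carrier L" "y \<in> carrier L" "x' \<in> carrier L" "y' \<in> carrier L" "x \<sqsubseteq> x'" "y \<sqsubseteq> y'"
  shows "x \<sqinter> y \<sqsubseteq> x' \<sqinter> y'"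
  using assms by (meson le_trans meet_closed meet_le meet_left meet_right)

lemma meet_sup_distrib:
  assumes "V \<in> carrier L" "A \<subseteq> carrier L"
  shows "\<Squnion>A \<sqinter> V = \<Squnion>((\<lambda>U. U \<sqinter> V) ` A)"
  using inf_sup_distrib[OF assms] by (simp add: meet_comm)

lemma meet_join_distrib:
  assumes "x \<in> carrier L" "y \<in> carrier L" "z \<in> carrier L"
  shows "x \<sqinter> (y \<squnion> z) = (x \<sqinter> y) \<squnion> (x \<sqinter> z)"
  using inf_sup_distrib[of x "{y, z}"] assms by (simp add: join_def)

lemma sup_le_iff:
  assumes "A \<subseteq> carrier L" "z \<in> carrier L"
  shows "\<Squnion>A \<sqsubseteq> z \<longleftrightarrow> (\<forall>x\<in>A. x \<sqsubseteq> z)"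
  using assms by (meson in_mono le_trans sup_closed sup_least sup_upper)

lemma heyting_closed [simp]: "a \<rightharpoonup> b \<in> carrier L"
  unfolding heyting_def by (rule sup_closed) auto

lemma le_heyting_iff:
  assumes a: "a \<in> carrier L" and b: "b \<in> carrier L" and c: "c \<in> carrier L"
  shows "c \<sqsubseteq> a \<rightharpoonup> b \<longleftrightarrow> c \<sqinter> a \<sqsubseteq> b"
proof
  let ?C = "{c \<in> carrier L. c \<sqinter> a \<sqsubseteq> b}"
  have C: "?C \<subseteq> carrier L" by auto
  assume "c \<sqsubseteq> a \<rightharpoonup> b"
  then have "c \<sqinter> a \<sqsubseteq> (a \<rightharpoonup> b) \<sqinter> a"
    using a c by (intro meet_mono) auto
  also have "(a \<rightharpoonup> b) \<sqinter> a = \<Squnion>((\<lambda>U. U \<sqinter> a) ` ?C)"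
    unfolding heyting_def by (rule meet_sup_distrib[OF a C])
  also have "\<dots> \<sqsubseteq> b"
    using a b by (intro sup_least) auto
  finally have "\<lbrakk>c \<sqinter> a \<in> carrier L; \<Squnion>((\<lambda>U. U \<sqinter> a) ` ?C) \<in> carrier L; b \<in> carrier L\<rbrakk> \<Longrightarrow> c \<sqinter> a \<sqsubseteq> b" .
  moreover have "\<Squnion>((\<lambda>U. U \<sqinter> a) ` ?C) \<in> carrier L"
    using a by (intro sup_closed) auto
  ultimately show "c \<sqinter> a \<sqsubseteq> b"
    using a b c by simp
next
  assume "c \<sqinter> a \<sqsubseteq> b"
  then show "c \<sqsubseteq> a \<rightharpoonup> b"
    unfolding heyting_def using c by (intro sup_upper) auto
qed

lemma heyting_meet_le:
  assumes "a \<in> carrier L" "b \<in> carrier L"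
  shows "(a \<rightharpoonup> b) \<sqinter> a \<sqsubseteq> b"
  using assms le_heyting_iff[of a b "a \<rightharpoonup> b"] by auto

lemma heyting_inf:
  assumes a: "a \<in> carrier L" and A: "A \<subseteq> carrier L"
  shows "a \<rightharpoonup> \<Sqinter>A = \<Sqinter>((\<lambda>s. a \<rightharpoonup> s) ` A)"
proof (rule inf_eqI[symmetric])
  fix x assume "x \<in> (\<lambda>s. a \<rightharpoonup> s) ` A"
  then obtain s where s: "s \<in> A" "x = a \<rightharpoonup> s" by blast
  have "(a \<rightharpoonup> \<Sqinter>A) \<sqinter> a \<sqsubseteq> \<Sqinter>A" using a A by (intro heyting_meet_le) auto
  moreover have "\<Sqinter>A \<sqsubseteq> s" using A s by (intro inf_lower)
  ultimately have "(a \<rightharpoonup> \<Sqinter>A) \<sqinter> a \<sqsubseteq> s"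
    using a A s by (meson heyting_closed in_mono inf_closed le_trans meet_closed)
  then show "a \<rightharpoonup> \<Sqinter>A \<sqsubseteq> x"
    using s a A le_heyting_iff[of a s "a \<rightharpoonup> \<Sqinter>A"] by auto
next
  fix y assume y: "y \<in> carrier L" "\<And>x. x \<in> (\<lambda>s. a \<rightharpoonup> s) ` A \<Longrightarrow> y \<sqsubseteq> x"
  then have "y \<sqinter> a \<sqsubseteq> s" if "s \<in> A" for s
    using that a A le_heyting_iff[of a s y] by auto
  then have "y \<sqinter> a \<sqsubseteq> \<Sqinter>A" using y a A by (intro inf_greatest) auto
  then show "y \<sqsubseteq> a \<rightharpoonup> \<Sqinter>A" using y a A le_heyting_iff[of a "\<Sqinter>A" y] by auto
qed auto

lemma heyting_meet:
  assumes "a \<in> carrier L" "x \<in> carrier L" "y \<in> carrier L"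
  shows "a \<rightharpoonup> (x \<sqinter> y) = (a \<rightharpoonup> x) \<sqinter> (a \<rightharpoonup> y)"
  using heyting_inf[of a "{x, y}"] assms by (simp add: meet_def)

lemma complement_unique:
  assumes car: "x \<in> carrier L" "y \<in> carrier L" "z \<in> carrier L"
    and "x \<sqinter> y = \<bottom>" "x \<squnion> y = \<top>" "x \<sqinter> z = \<bottom>" "x \<squnion> z = \<top>"
  shows "y = z"
proof -
  have *: "b \<sqsubseteq> c" if "b \<in> carrier L" "c \<in> carrier L" "x \<sqinter> b = \<bottom>" "x \<squnion> c = \<top>" for b c
  proof -
    have "b = b \<sqinter> (x \<squnion> c)"
      using that car by (metis le_iff_join top_closed top_higher)
    also have "\<dots> = (b \<sqinter> x) \<squnion> (b \<sqinter> c)"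
      using that car by (intro meet_join_distrib)
    also have "\<dots> = b \<sqinter> c"
      using that car by (metis bottom_lower le_iff_meet meet_closed meet_comm)
    finally show ?thesis using that by (metis meet_right)
  qed
  show ?thesis using * assms by (intro le_antisym) auto
qed

end

lemma (in partial_order) eq_if_same_lower:
  assumes "x \<in> carrier L" "y \<in> carrier L" "\<And>z. z \<in> carrier L \<Longrightarrow> z \<sqsubseteq> x \<longleftrightarrow> z \<sqsubseteq> y"
  shows "x = y"
  using assms by (meson le_antisym le_refl)

lemma (in partial_order) eq_if_same_upper:
  assumes "x \<in> carrier L" "y \<in> carrier L" "\<And>z. z \<in> carrier L \<Longrightarrow> x \<sqsubseteq> z \<longleftrightarrow> y \<sqsubseteq> z"
  shows "x = y"
  using assms by (meson le_antisym le_refl)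

context frame
begin

lemma meet_top [simp]:
  assumes "x \<in> carrier L" shows "x \<sqinter> \<top> = x" "\<top> \<sqinter> x = x"
  using assms le_iff_join[of x "\<top>"] by (auto simp: meet_comm)

lemma join_bottom [simp]:
  assumes "x \<in> carrier L" shows "x \<squnion> \<bottom> = x" "\<bottom> \<squnion> x = x"
  using assms le_iff_meet[of "\<bottom>" x] by (auto simp: join_comm)

lemma heyting_commute:
  assumes "a \<in> carrier L" "b \<in> carrier L" "c \<in> carrier L"
  shows "a \<rightharpoonup> (b \<rightharpoonup> c) = b \<rightharpoonup> (a \<rightharpoonup> c)"
proof (rule eq_if_same_lower)
  fix z assume "z \<in> carrier L"
  then show "z \<sqsubseteq> a \<rightharpoonup> (b \<rightharpoonup> c) \<longleftrightarrow> z \<sqsubseteq> b \<rightharpoonup> (a \<rightharpoonup> c)"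
    using assms by (simp add: le_heyting_iff) (metis meet_assoc meet_comm)
qed auto

lemma le_heyting:
  assumes "a \<in> carrier L" "b \<in> carrier L"
  shows "b \<sqsubseteq> a \<rightharpoonup> b"
  using assms by (simp add: le_heyting_iff meet_left)

lemma heyting_eq_top:
  assumes "a \<in> carrier L" "b \<in> carrier L" "a \<sqsubseteq> b"
  shows "a \<rightharpoonup> b = \<top>"
proof (rule top_eqI[symmetric])
  fix x assume "x \<in> carrier L"
  then show "x \<sqsubseteq> a \<rightharpoonup> b"
    using assms by (simp add: le_heyting_iff) (meson le_trans meet_closed meet_right)
qed simp

lemma meet_heyting:
  assumes "a \<in> carrier L" "b \<in> carrier L"
  shows "a \<sqinter> (a \<rightharpoonup> b) = a \<sqinter> b"
proof (rule le_antisym)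
  show "a \<sqinter> (a \<rightharpoonup> b) \<sqsubseteq> a \<sqinter> b"
    using assms heyting_meet_le[of a b] by (simp add: le_meet_iff meet_left meet_comm)
  show "a \<sqinter> b \<sqsubseteq> a \<sqinter> (a \<rightharpoonup> b)"
    using assms by (intro meet_mono) (auto intro: le_heyting)
qed (use assms in auto)

end

section \<open>Sublocales as sets closed under meets and implication\<close>

text \<open>For a sublocale \<open>S\<close>, the left adjoint of its inclusion, regarded as a closure operator on \<open>L\<close>.\<close>

definition nucleus :: "'a gorder \<Rightarrow> 'a set \<Rightarrow> 'a \<Rightarrow> 'a"
  where "nucleus L S x = \<Sqinter>\<^bsub>L\<^esub>{s \<in> S. x \<sqsubseteq>\<^bsub>L\<^esub> s}"

text \<open>Closure under meets provides the left adjoint of the inclusion, and closure under implication makes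
this adjoint preserve binary meets. Unlike the definition of a sublocale, these conditions pass
easily to intersections and can be checked on elements.\<close>

locale frame_sublocale = frame L for L :: "'a gorder" (structure) +
  fixes S :: "'a set"
  assumes subset: "S \<subseteq> carrier L"
    and inf_mem: "A \<subseteq> S \<Longrightarrow> \<Sqinter>A \<in> S"
    and heyting_mem: "\<lbrakk>a \<in> carrier L; s \<in> S\<rbrakk> \<Longrightarrow> a \<rightharpoonup> s \<in> S"
begin

lemma mem_carrier [intro]: "s \<in> S \<Longrightarrow> s \<in> carrier L"
  using subset by auto

lemma meet_mem: "\<lbrakk>s \<in> S; t \<in> S\<rbrakk> \<Longrightarrow> s \<sqinter> t \<in> S"
  unfolding meet_def by (rule inf_mem) auto

lemma top_mem: "\<top> \<in> S"
  using inf_mem[of "{}"] weak_inf_empty by (simp add: eq_is_equal)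

lemma nucleus_mem [simp]: "nucleus L S x \<in> S"
  unfolding nucleus_def by (rule inf_mem) auto

lemma nucleus_closed [simp]: "nucleus L S x \<in> carrier L"
  using nucleus_mem by (rule mem_carrier)

lemma nucleus_upper: "x \<in> carrier L \<Longrightarrow> x \<sqsubseteq> nucleus L S x"
  unfolding nucleus_def using subset by (intro inf_greatest) auto

lemma nucleus_le_iff:
  assumes "x \<in> carrier L" "s \<in> S"
  shows "nucleus L S x \<sqsubseteq> s \<longleftrightarrow> x \<sqsubseteq> s"
proof
  assume "nucleus L S x \<sqsubseteq> s"
  then show "x \<sqsubseteq> s" using assms nucleus_upper by (meson le_trans mem_carrier nucleus_closed)
next
  assume "x \<sqsubseteq> s"
  then show "nucleus L S x \<sqsubseteq> s"
    unfolding nucleus_def using assms subset by (intro inf_lower) auto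
qed

lemma le_nucleus_sup:
  assumes "A \<subseteq> carrier L" "x \<in> A"
  shows "x \<sqsubseteq> nucleus L S (\<Squnion>A)"
  using assms by (meson le_trans nucleus_closed nucleus_upper subsetD sup_closed sup_upper)

lemma nucleus_id: "s \<in> S \<Longrightarrow> nucleus L S s = s"
  by (rule le_antisym) (auto simp: nucleus_le_iff nucleus_upper mem_carrier)

lemma nucleus_mono:
  assumes "x \<in> carrier L" "y \<in> carrier L" "x \<sqsubseteq> y"
  shows "nucleus L S x \<sqsubseteq> nucleus L S y"
  using assms nucleus_upper[of y] by (subst nucleus_le_iff) (auto intro: le_trans)

text \<open>By adjointness of meet and implication, \<open>x \<sqinter> y \<sqsubseteq> s\<close> says that \<open>x\<close> lies below \<open>y \<rightharpoonup> s\<close>. As this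
element belongs to \<open>S\<close>, one may replace \<open>x\<close> by its closure, and then \<open>y\<close> by its closure in the same way.\<close>

lemma nucleus_meet:
  assumes x: "x \<in> carrier L" and y: "y \<in> carrier L"
  shows "nucleus L S (x \<sqinter> y) = nucleus L S x \<sqinter> nucleus L S y"
proof (rule le_antisym)
  show "nucleus L S (x \<sqinter> y) \<sqsubseteq> nucleus L S x \<sqinter> nucleus L S y"
    using x y by (intro meet_le nucleus_mono) (auto simp: meet_left meet_right)
next
  define s where "s = nucleus L S (x \<sqinter> y)"
  have s: "s \<in> S" "s \<in> carrier L" by (auto simp: s_def)
  have "x \<sqinter> y \<sqsubseteq> s"
    using x y by (auto simp: s_def intro: nucleus_upper)
  then have "x \<sqsubseteq> y \<rightharpoonup> s"
    using x y s by (simp add: le_heyting_iff)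
  then have "nucleus L S x \<sqsubseteq> y \<rightharpoonup> s"
    using x y s by (subst nucleus_le_iff) (auto intro: heyting_mem)
  then have "y \<sqsubseteq> nucleus L S x \<rightharpoonup> s"
    using x y s by (simp add: le_heyting_iff meet_comm)
  then have "nucleus L S y \<sqsubseteq> nucleus L S x \<rightharpoonup> s"
    using x y s by (subst nucleus_le_iff) (auto intro: heyting_mem)
  then show "nucleus L S x \<sqinter> nucleus L S y \<sqsubseteq> s"
    using x y s by (simp add: le_heyting_iff meet_comm)
qed auto

abbreviation "Sub \<equiv> L\<lparr>carrier := S\<rparr>"

lemma partial_order_Sub: "partial_order Sub"
proof -
  interpret W: weak_partial_order Sub
    using weak_partial_order_axioms subset by (rule weak_partial_order_subset)
  show ?thesis
    by unfold_locales (simp add: eq_is_equal)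
qed

lemma complete_lattice_Sub: "complete_lattice Sub"
proof -
  interpret S: partial_order Sub by (rule partial_order_Sub)
  show ?thesis
  proof (rule S.complete_latticeI)
    fix A assume A: "A \<subseteq> carrier Sub"
    then have "A \<subseteq> carrier L" using subset by auto
    then have "least Sub (nucleus L S (\<Squnion>A)) (Upper Sub A)"
      using A
      by (intro least_UpperI)
        (auto simp: nucleus_le_iff sup_le_iff Upper_def mem_carrier le_nucleus_sup)
    then show "\<exists>s. least Sub s (Upper Sub A)" ..
    have "greatest Sub (\<Sqinter>A) (Lower Sub A)"
      using A \<open>A \<subseteq> carrier L\<close>
      by (intro greatest_LowerI) (auto simp: Lower_def inf_mem intro!: inf_lower inf_greatest)
    then show "\<exists>s. greatest Sub s (Lower Sub A)" ..
  qed
qed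

lemma sup_Sub:
  assumes "A \<subseteq> S" shows "\<Squnion>\<^bsub>Sub\<^esub>A = nucleus L S (\<Squnion>A)"
proof -
  interpret S: partial_order Sub by (rule partial_order_Sub)
  have AL: "A \<subseteq> carrier L" using subset assms by auto
  show ?thesis
    using assms AL
    by (intro S.sup_eqI)
      (auto simp: nucleus_le_iff sup_le_iff mem_carrier le_nucleus_sup)
qed

lemma meet_Sub:
  assumes "x \<in> S" "y \<in> S" shows "x \<sqinter>\<^bsub>Sub\<^esub> y = x \<sqinter> y"
proof -
  interpret S: partial_order Sub by (rule partial_order_Sub)
  show ?thesis
    using assms by (intro S.meet_eqI) (auto simp: meet_mem meet_left meet_right mem_carrier intro: meet_le)
qed

lemma nucleus_sup_nucleus:
  assumes A: "A \<subseteq> carrier L"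
  shows "nucleus L S (\<Squnion>(nucleus L S ` A)) = nucleus L S (\<Squnion>A)"
proof -
  have im: "nucleus L S ` A \<subseteq> carrier L" by auto
  have "nucleus L S (\<Squnion>(nucleus L S ` A)) \<sqsubseteq> s \<longleftrightarrow> nucleus L S (\<Squnion>A) \<sqsubseteq> s" if "s \<in> S" for s
    using that A im by (auto simp: nucleus_le_iff sup_le_iff mem_carrier subset_iff)
  then show ?thesis
    by (metis le_antisym le_refl nucleus_closed nucleus_mem)
qed

text \<open>Joins in \<open>S\<close> are closures of joins in \<open>L\<close>, and taking closures preserves binary meets; so the
distributive law of \<open>L\<close> descends to \<open>S\<close>.\<close>

lemma frame_Sub: "frame Sub"
proof -
  interpret S: complete_lattice Sub by (rule complete_lattice_Sub)
  show ?thesis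
  proof (rule S.frameI)
    fix V A assume "V \<in> carrier Sub" "A \<subseteq> carrier Sub"
    then have V: "V \<in> S" "V \<in> carrier L" and A: "A \<subseteq> S" "A \<subseteq> carrier L"
      using subset by auto
    have *: "(\<lambda>U. V \<sqinter> U) ` A \<subseteq> S" using V A by (auto intro: meet_mem)
    have "V \<sqinter>\<^bsub>Sub\<^esub> \<Squnion>\<^bsub>Sub\<^esub>A = nucleus L S V \<sqinter> nucleus L S (\<Squnion>A)"
      using V A by (simp add: sup_Sub meet_Sub nucleus_id)
    also have "\<dots> = nucleus L S (V \<sqinter> \<Squnion>A)"
      using V A by (intro nucleus_meet[symmetric]) auto
    also have "\<dots> = nucleus L S (\<Squnion>((\<lambda>U. V \<sqinter> U) ` A))"
      using V A by (simp add: inf_sup_distrib)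
    also have "\<dots> = \<Squnion>\<^bsub>Sub\<^esub>((\<lambda>U. V \<sqinter> U) ` A)"
      using * by (simp add: sup_Sub)
    also have "(\<lambda>U. V \<sqinter> U) ` A = (\<lambda>U. V \<sqinter>\<^bsub>Sub\<^esub> U) ` A"
      using V A by (intro image_cong) (auto simp: meet_Sub)
    finally have "V \<sqinter>\<^bsub>Sub\<^esub> \<Squnion>\<^bsub>Sub\<^esub>A = \<Squnion>\<^bsub>Sub\<^esub>((\<lambda>U. V \<sqinter>\<^bsub>Sub\<^esub> U) ` A)" .
    then show "V \<sqinter>\<^bsub>Sub\<^esub> \<Squnion>\<^bsub>Sub\<^esub>A \<sqsubseteq>\<^bsub>Sub\<^esub> \<Squnion>\<^bsub>Sub\<^esub>((\<lambda>U. V \<sqinter>\<^bsub>Sub\<^esub> U) ` A)"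
      using V A by (metis S.le_refl S.meet_closed S.sup_closed \<open>A \<subseteq> carrier Sub\<close> \<open>V \<in> carrier Sub\<close>)
  qed
qed

lemma frame_hom_nucleus: "frame_hom L Sub (nucleus L S)"
proof -
  interpret S: frame Sub by (rule frame_Sub)
  have "nucleus L S \<top> = \<top>\<^bsub>Sub\<^esub>"
    by (rule S.top_eqI[symmetric]) (auto simp: top_mem mem_carrier nucleus_id)
  moreover have "nucleus L S (\<Squnion>A) = \<Squnion>\<^bsub>Sub\<^esub>(nucleus L S ` A)" if "A \<subseteq> carrier L" for A
    using that by (subst sup_Sub) (auto simp: nucleus_sup_nucleus)
  ultimately show ?thesis
    by unfold_locales (auto simp: nucleus_meet meet_Sub)
qed

lemma is_sublocale: "is_sublocale L S"
  unfolding is_sublocale_def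
proof (intro conjI exI)
  show "galois_connection \<lparr>orderA = L, orderB = Sub, lower = nucleus L S, upper = (\<lambda>s. s)\<rparr>"
    by (intro galois_connection.intro connection.intro galois_connection_axioms.intro)
      (auto simp: nucleus_le_iff partial_order_Sub partial_order_axioms)
qed (auto simp: frame_Sub frame_hom_nucleus mem_carrier)

end

text \<open>If \<open>h\<close> is a meet-preserving left adjoint of the inclusion, then
\<open>h (a \<rightharpoonup> s) \<sqinter> a \<sqsubseteq> h (a \<rightharpoonup> s) \<sqinter> h a = h ((a \<rightharpoonup> s) \<sqinter> a) \<sqsubseteq> s\<close>, so that \<open>a \<rightharpoonup> s\<close> is fixed by \<open>h\<close>.\<close>

lemma is_sublocale_iff:
  fixes L :: "'a gorder" (structure)
  assumes "frame L"
  shows "is_sublocale L S \<longleftrightarrow> frame_sublocale L S"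
proof
  assume "is_sublocale L S"
  then obtain h where sub: "S \<subseteq> carrier L" and hom: "frame_hom L (L\<lparr>carrier := S\<rparr>) h"
    and gc: "galois_connection \<lparr>orderA = L, orderB = L\<lparr>carrier := S\<rparr>, lower = h, upper = (\<lambda>s. s)\<rparr>"
    unfolding is_sublocale_def by blast
  interpret frame L by fact
  interpret h: frame_hom L "L\<lparr>carrier := S\<rparr>" h by fact
  have h_mem: "h x \<in> S" if "x \<in> carrier L" for x
    using h.hom_closed that by auto
  have h_le: "h x \<sqsubseteq> s \<longleftrightarrow> x \<sqsubseteq> s" if "x \<in> carrier L" "s \<in> S" for x s
    using galois_connection.galois_property[OF gc] that by simp
  have h_upper: "x \<sqsubseteq> h x" if "x \<in> carrier L" for x
    using that h_mem h_le[of x "h x"] sub by (auto simp: subset_iff)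
  have memI: "x \<in> S" if "x \<in> carrier L" "h x \<sqsubseteq> x" for x
    using that h_mem h_upper sub by (metis le_antisym subsetD)
  have inf_mem: "\<Sqinter>A \<in> S" if A: "A \<subseteq> S" for A
  proof (rule memI)
    have AL: "A \<subseteq> carrier L" using A sub by auto
    then show "\<Sqinter>A \<in> carrier L" by simp
    show "h (\<Sqinter>A) \<sqsubseteq> \<Sqinter>A"
    proof (rule inf_greatest)
      fix x assume "x \<in> A"
      then show "h (\<Sqinter>A) \<sqsubseteq> x"
        using A AL by (subst h_le) (auto intro: inf_lower)
    qed (use AL sub h_mem in auto)
  qed
  have meet_mem: "x \<sqinter> y \<in> S" if "x \<in> S" "y \<in> S" for x y
    unfolding meet_def using that by (intro inf_mem) auto
  have h_meet: "h (x \<sqinter> y) = h x \<sqinter> h y" if "x \<in> carrier L" "y \<in> carrier L" for x y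
  proof -
    have "h (x \<sqinter> y) = h x \<sqinter>\<^bsub>L\<lparr>carrier := S\<rparr>\<^esub> h y"
      using that by (rule h.hom_inf)
    also have "\<dots> = h x \<sqinter> h y"
      using that sub by (intro h.B.meet_eqI) (auto simp: h_mem meet_mem intro!: meet_left meet_right meet_le)
    finally show ?thesis .
  qed
  have heyting_mem: "a \<rightharpoonup> s \<in> S" if a: "a \<in> carrier L" and s: "s \<in> S" for a s
  proof (rule memI)
    have sL: "s \<in> carrier L" using s sub by auto
    have hc: "h (a \<rightharpoonup> s) \<in> carrier L" "h a \<in> carrier L" using a h_mem sub by auto
    have "h (a \<rightharpoonup> s) \<sqinter> a \<sqsubseteq> h (a \<rightharpoonup> s) \<sqinter> h a"
      using a hc h_upper by (intro meet_mono) auto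
    also have "\<dots> = h ((a \<rightharpoonup> s) \<sqinter> a)"
      using a by (simp add: h_meet)
    also have "\<dots> \<sqsubseteq> s"
      using a s sL by (simp add: h_le heyting_meet_le)
    finally show "h (a \<rightharpoonup> s) \<sqsubseteq> a \<rightharpoonup> s"
      using a sL hc h_mem sub by (simp add: le_heyting_iff subset_iff)
  qed simp
  show "frame_sublocale L S"
    by unfold_locales (use sub inf_mem heyting_mem in auto)
next
  assume "frame_sublocale L S"
  then show "is_sublocale L S" by (rule frame_sublocale.is_sublocale)
qed

section \<open>The frame of sublocales\<close>

text \<open>The image of the nucleus \<open>x \<mapsto> (V \<rightharpoonup> x)\<close>. It is the complement of the closed sublocale \<open>can L V\<close>.\<close>

definition open_sublocale :: "'a gorder \<Rightarrow> 'a \<Rightarrow> 'a set"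
  where "open_sublocale L V = (\<lambda>x. V \<rightharpoonup>\<^bsub>L\<^esub> x) ` carrier L"

definition sublocale_join :: "'a gorder \<Rightarrow> 'a set \<Rightarrow> 'a set \<Rightarrow> 'a set"
  where "sublocale_join L S T = {s \<sqinter>\<^bsub>L\<^esub> t | s t. s \<in> S \<and> t \<in> T}"

lemma complete_lattice_dual:
  assumes "complete_lattice L"
  shows "complete_lattice (inv_gorder L)"
proof -
  interpret complete_lattice L by fact
  interpret D: partial_order "inv_gorder L" by (rule dual_order)
  show ?thesis
    by unfold_locales (simp_all add: sup_exists inf_exists)
qed

lemma complete_lattice_moore_family:
  assumes T: "T \<in> C" "\<And>X. X \<in> C \<Longrightarrow> X \<subseteq> T" and Int: "\<And>\<A>. \<A> \<subseteq> C \<Longrightarrow> T \<inter> \<Inter>\<A> \<in> C"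
  shows "complete_lattice \<lparr>carrier = C, eq = (=), le = (\<subseteq>)\<rparr>" (is "complete_lattice ?P")
proof -
  interpret partial_order ?P
    by unfold_locales auto
  show ?thesis
  proof (rule complete_lattice_criterion1)
    show "\<exists>g. greatest ?P g (carrier ?P)"
      using T by (intro exI[of _ T]) (auto simp: greatest_def)
    fix \<A> assume "\<A> \<subseteq> carrier ?P"
    then have "greatest ?P (T \<inter> \<Inter>\<A>) (Lower ?P \<A>)"
      using T Int by (intro greatest_LowerI) (auto simp: Lower_def Int_absorb2 subset_iff)
    then show "\<exists>i. greatest ?P i (Lower ?P \<A>)" ..
  qed
qed

lemma sublocale_locale_simps [simp]:
  "carrier (sublocale_locale L) = {S. is_sublocale L S}"
  "S \<sqsubseteq>\<^bsub>sublocale_locale L\<^esub> T \<longleftrightarrow> T \<subseteq> S"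
  by (simp_all add: sublocale_locale_def sublocale_order_def)

locale gorder_frame = frame L for L :: "'a gorder" (structure)
begin

lemma sublocale_iff: "is_sublocale L S \<longleftrightarrow> frame_sublocale L S"
  by (rule is_sublocale_iff) (rule frame_axioms)

lemma is_sublocaleI:
  assumes "S \<subseteq> carrier L" "\<And>A. A \<subseteq> S \<Longrightarrow> \<Sqinter>A \<in> S" "\<And>a s. \<lbrakk>a \<in> carrier L; s \<in> S\<rbrakk> \<Longrightarrow> a \<rightharpoonup> s \<in> S"
  shows "is_sublocale L S"
  unfolding sublocale_iff by unfold_locales (use assms in auto)

lemma sublocale_subset: "is_sublocale L S \<Longrightarrow> S \<subseteq> carrier L"
  by (simp add: is_sublocale_def)

lemma is_sublocale_Inter:
  assumes "\<And>S. S \<in> \<A> \<Longrightarrow> is_sublocale L S"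
  shows "is_sublocale L (carrier L \<inter> \<Inter>\<A>)"
proof (rule is_sublocaleI)
  have S: "frame_sublocale L S" if "S \<in> \<A>" for S
    using assms that by (simp add: sublocale_iff)
  show "\<Sqinter>A \<in> carrier L \<inter> \<Inter>\<A>" if "A \<subseteq> carrier L \<inter> \<Inter>\<A>" for A
    using that by (auto simp: le_Inf_iff intro!: frame_sublocale.inf_mem[OF S])
  show "a \<rightharpoonup> s \<in> carrier L \<inter> \<Inter>\<A>" if "a \<in> carrier L" "s \<in> carrier L \<inter> \<Inter>\<A>" for a s
    using that frame_sublocale.heyting_mem[OF S] by auto
qed auto

lemma is_sublocale_can:
  assumes U: "U \<in> carrier L"
  shows "is_sublocale L (can L U)"
proof (rule is_sublocaleI)
  show "a \<rightharpoonup> s \<in> can L U" if "a \<in> carrier L" "s \<in> can L U" for a s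
    using that U by (auto simp: can_def intro: le_trans[of U s] le_heyting)
qed (use U in \<open>auto simp: can_def subset_iff intro!: inf_greatest inf_closed\<close>)

lemma is_sublocale_open:
  assumes V: "V \<in> carrier L"
  shows "is_sublocale L (open_sublocale L V)"
proof (rule is_sublocaleI)
  fix A assume A: "A \<subseteq> open_sublocale L V"
  define B where "B = {x \<in> carrier L. V \<rightharpoonup> x \<in> A}"
  have "A = (\<lambda>x. V \<rightharpoonup> x) ` B"
    using A by (auto simp: B_def open_sublocale_def)
  moreover have "B \<subseteq> carrier L" by (auto simp: B_def)
  ultimately have "\<Sqinter>A = V \<rightharpoonup> \<Sqinter>B" "\<Sqinter>B \<in> carrier L"
    using V by (auto simp: heyting_inf)
  then show "\<Sqinter>A \<in> open_sublocale L V"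
    by (auto simp: open_sublocale_def)
next
  fix a s assume "a \<in> carrier L" "s \<in> open_sublocale L V"
  then show "a \<rightharpoonup> s \<in> open_sublocale L V"
    using V by (auto simp: open_sublocale_def heyting_commute[of a V])
qed (auto simp: open_sublocale_def)

lemma is_sublocale_carrier: "is_sublocale L (carrier L)"
  by (rule is_sublocaleI) auto

text \<open>A meet \<open>m\<close> of elements \<open>s \<sqinter> t\<close> equals \<open>nucleus L S m \<sqinter> nucleus L T m\<close>, because \<open>m \<sqsubseteq> s\<close> already implies
\<open>nucleus L S m \<sqsubseteq> s\<close>, and likewise for \<open>t\<close>.\<close>

lemma is_sublocale_join:
  assumes "is_sublocale L S" "is_sublocale L T"
  shows "is_sublocale L (sublocale_join L S T)"
proof (rule is_sublocaleI)
  interpret S: frame_sublocale L S using assms by (simp add: sublocale_iff)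
  interpret T: frame_sublocale L T using assms by (simp add: sublocale_iff)
  show sub: "sublocale_join L S T \<subseteq> carrier L"
    by (auto simp: sublocale_join_def S.mem_carrier T.mem_carrier)
  show "a \<rightharpoonup> x \<in> sublocale_join L S T" if a: "a \<in> carrier L" and x: "x \<in> sublocale_join L S T" for a x
  proof -
    obtain s t where st: "s \<in> S" "t \<in> T" "x = s \<sqinter> t"
      using x by (auto simp: sublocale_join_def)
    then have "a \<rightharpoonup> x = (a \<rightharpoonup> s) \<sqinter> (a \<rightharpoonup> t)"
      using a by (auto intro: heyting_meet)
    then show ?thesis
      unfolding sublocale_join_def using a st S.heyting_mem T.heyting_mem by blast
  qed
  fix A assume A: "A \<subseteq> sublocale_join L S T"
  then have AL: "A \<subseteq> carrier L" using sub by auto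
  define m where "m = \<Sqinter>A"
  have m: "m \<in> carrier L" using AL by (simp add: m_def)
  have "m = nucleus L S m \<sqinter> nucleus L T m"
  proof (rule le_antisym)
    show "m \<sqsubseteq> nucleus L S m \<sqinter> nucleus L T m"
      using m by (intro meet_le) (auto intro: S.nucleus_upper T.nucleus_upper)
    have "nucleus L S m \<sqinter> nucleus L T m \<sqsubseteq> a" if a: "a \<in> A" for a
    proof -
      obtain s t where st: "s \<in> S" "t \<in> T" "a = s \<sqinter> t"
        using A a by (auto simp: sublocale_join_def)
      have car: "s \<in> carrier L" "t \<in> carrier L" using st by auto
      have "m \<sqsubseteq> a" unfolding m_def using AL a by (rule inf_lower)
      then have "m \<sqsubseteq> s" "m \<sqsubseteq> t"
        using st car m by (auto simp: le_meet_iff)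
      then show ?thesis
        unfolding st(3) using st car m by (intro meet_mono) (auto simp: S.nucleus_le_iff T.nucleus_le_iff)
    qed
    then show "nucleus L S m \<sqinter> nucleus L T m \<sqsubseteq> m"
      using AL unfolding m_def by (intro inf_greatest) auto
  qed (use m in auto)
  then show "\<Sqinter>A \<in> sublocale_join L S T"
    unfolding sublocale_join_def m_def[symmetric] using S.nucleus_mem T.nucleus_mem by blast
qed

lemma subset_sublocale_join:
  assumes "is_sublocale L S" "is_sublocale L T"
  shows "S \<subseteq> sublocale_join L S T" "T \<subseteq> sublocale_join L S T"
proof -
  interpret S: frame_sublocale L S using assms by (simp add: sublocale_iff)
  interpret T: frame_sublocale L T using assms by (simp add: sublocale_iff)
  have "s = s \<sqinter> \<top>" if "s \<in> carrier L" for s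
    using that by simp
  then show "S \<subseteq> sublocale_join L S T"
    unfolding sublocale_join_def using T.top_mem S.mem_carrier by blast
  have "s = \<top> \<sqinter> s" if "s \<in> carrier L" for s
    using that by simp
  then show "T \<subseteq> sublocale_join L S T"
    unfolding sublocale_join_def using S.top_mem T.mem_carrier by blast
qed

lemma complete_lattice_sublocale_locale: "complete_lattice (sublocale_locale L)"
  unfolding sublocale_locale_def sublocale_order_def
proof (intro complete_lattice_dual complete_lattice_moore_family)
  show "carrier L \<in> {S. is_sublocale L S}" by (simp add: is_sublocale_carrier)
  show "X \<subseteq> carrier L" if "X \<in> {S. is_sublocale L S}" for X
    using that by (simp add: is_sublocale_def)
  show "carrier L \<inter> \<Inter>\<A> \<in> {S. is_sublocale L S}" if "\<A> \<subseteq> {S. is_sublocale L S}" for \<A>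
    using that is_sublocale_Inter by auto
qed

sublocale Sl: complete_lattice "sublocale_locale L"
  by (rule complete_lattice_sublocale_locale)

lemma sup_sublocale_locale:
  assumes "\<A> \<subseteq> {S. is_sublocale L S}"
  shows "\<Squnion>\<^bsub>sublocale_locale L\<^esub>\<A> = carrier L \<inter> \<Inter>\<A>"
proof (rule Sl.sup_eqI)
  show "carrier L \<inter> \<Inter>\<A> \<in> carrier (sublocale_locale L)"
    using assms by (auto intro: is_sublocale_Inter)
qed (use assms in \<open>auto simp: is_sublocale_def\<close>)

lemma meet_sublocale_locale:
  assumes S: "is_sublocale L S" and T: "is_sublocale L T"
  shows "S \<sqinter>\<^bsub>sublocale_locale L\<^esub> T = sublocale_join L S T"
proof (rule Sl.meet_eqI)
  fix Z assume Z: "Z \<in> carrier (sublocale_locale L)"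
    "Z \<sqsubseteq>\<^bsub>sublocale_locale L\<^esub> S" "Z \<sqsubseteq>\<^bsub>sublocale_locale L\<^esub> T"
  then interpret Z: frame_sublocale L Z by (simp add: sublocale_iff)
  show "Z \<sqsubseteq>\<^bsub>sublocale_locale L\<^esub> sublocale_join L S T"
    using Z by (auto simp: sublocale_join_def intro: Z.meet_mem)
qed (use S T subset_sublocale_join is_sublocale_join in auto)

text \<open>The order is reversed, so the distributive law says that an \<open>x\<close> lying in the join of \<open>V\<close> with each
\<open>T \<in> \<A>\<close> lies in the join of \<open>V\<close> with \<open>\<Inter>\<A>\<close>. With \<open>s\<close> the closure of \<open>x\<close> in \<open>V\<close> one has
\<open>x = s \<sqinter> (s \<rightharpoonup> x)\<close>, where the second factor does not depend on \<open>T\<close>. It belongs to every \<open>T\<close>: writing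
\<open>x = v \<sqinter> t\<close> gives \<open>s \<sqsubseteq> v\<close>, hence \<open>s \<rightharpoonup> x = s \<rightharpoonup> t\<close>.\<close>

lemma frame_sublocale_locale: "frame (sublocale_locale L)"
proof (rule Sl.frameI)
  let ?Sl = "sublocale_locale L"
  fix V \<A> assume "V \<in> carrier ?Sl" and "\<A> \<subseteq> carrier ?Sl"
  then have V: "is_sublocale L V" and \<A>: "\<And>S. S \<in> \<A> \<Longrightarrow> is_sublocale L S" by auto
  interpret V: frame_sublocale L V using V by (simp add: sublocale_iff)
  have img: "(\<lambda>U. V \<sqinter>\<^bsub>?Sl\<^esub> U) ` \<A> = sublocale_join L V ` \<A>"
    using V \<A> by (intro image_cong) (auto simp: meet_sublocale_locale)
  have lhs: "V \<sqinter>\<^bsub>?Sl\<^esub> \<Squnion>\<^bsub>?Sl\<^esub>\<A> = sublocale_join L V (carrier L \<inter> \<Inter>\<A>)"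
    using V \<A> by (subst sup_sublocale_locale)
      (auto intro!: meet_sublocale_locale is_sublocale_Inter subsetI del: equalityI)
  have rhs: "\<Squnion>\<^bsub>?Sl\<^esub>((\<lambda>U. V \<sqinter>\<^bsub>?Sl\<^esub> U) ` \<A>) = carrier L \<inter> (\<Inter>T\<in>\<A>. sublocale_join L V T)"
    unfolding img using V \<A> by (subst sup_sublocale_locale) (auto intro: is_sublocale_join)
  have "x \<in> sublocale_join L V (carrier L \<inter> \<Inter>\<A>)"
    if x: "x \<in> carrier L" and xT: "\<And>T. T \<in> \<A> \<Longrightarrow> x \<in> sublocale_join L V T" for x
  proof -
    define s where "s = nucleus L V x"
    have s: "s \<in> V" "s \<in> carrier L" "x \<sqsubseteq> s"
      using x V.nucleus_upper by (auto simp: s_def)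
    have "s \<rightharpoonup> x \<in> T" if T: "T \<in> \<A>" for T
    proof -
      interpret T: frame_sublocale L T using \<A> T by (simp add: sublocale_iff)
      obtain v t where vt: "v \<in> V" "t \<in> T" "x = v \<sqinter> t"
        using xT[OF T] by (auto simp: sublocale_join_def)
      then have car: "v \<in> carrier L" "t \<in> carrier L" by auto
      have "s \<sqsubseteq> v"
        unfolding s_def using x vt car by (simp add: V.nucleus_le_iff meet_left)
      then have "s \<rightharpoonup> v = \<top>" using s car by (simp add: heyting_eq_top)
      then have "s \<rightharpoonup> x = \<top> \<sqinter> (s \<rightharpoonup> t)"
        using s vt car by (simp add: heyting_meet)
      also have "\<dots> = s \<rightharpoonup> t"
        by simp
      finally show ?thesis using s vt T.heyting_mem by simp
    qed
    moreover have "x = s \<sqinter> (s \<rightharpoonup> x)"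
      using x s by (metis le_iff_join meet_comm meet_heyting)
    ultimately show ?thesis
      unfolding sublocale_join_def using s by (intro CollectI exI[of _ s] exI[of _ "s \<rightharpoonup> x"]) auto
  qed
  then show "V \<sqinter>\<^bsub>?Sl\<^esub> \<Squnion>\<^bsub>?Sl\<^esub>\<A> \<sqsubseteq>\<^bsub>?Sl\<^esub> \<Squnion>\<^bsub>?Sl\<^esub>((\<lambda>U. V \<sqinter>\<^bsub>?Sl\<^esub> U) ` \<A>)"
    unfolding lhs rhs by auto
qed

lemma top_sublocale_locale: "\<top>\<^bsub>sublocale_locale L\<^esub> = {\<top>}"
proof (rule Sl.top_eqI)
  have inf: "\<Sqinter>A = \<top>" if "A \<subseteq> {\<top>}" for A
    using that by (cases "A = {}") (auto simp: eq_is_equal subset_singleton_iff intro!: inf_eqI)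
  show "{\<top>} \<in> carrier (sublocale_locale L)"
    by (auto intro!: is_sublocaleI simp: inf heyting_eq_top)
  show "S \<sqsubseteq>\<^bsub>sublocale_locale L\<^esub> {\<top>}" if "S \<in> carrier (sublocale_locale L)" for S
    using that frame_sublocale.top_mem by (auto simp: sublocale_iff)
qed

lemma bottom_sublocale_locale: "\<bottom>\<^bsub>sublocale_locale L\<^esub> = carrier L"
  by (rule Sl.bottom_eqI) (auto simp: is_sublocale_carrier dest: sublocale_subset)

lemma join_sublocale_locale:
  assumes S: "is_sublocale L S" and T: "is_sublocale L T"
  shows "S \<squnion>\<^bsub>sublocale_locale L\<^esub> T = S \<inter> T"
  using sup_sublocale_locale[of "{S, T}"] assms unfolding join_def by (auto simp: is_sublocale_def)

lemma can_Int_open: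
  assumes V: "V \<in> carrier L"
  shows "can L V \<inter> open_sublocale L V = {\<top>}"
proof -
  have "V \<rightharpoonup> x = \<top>" if "x \<in> carrier L" "V \<sqsubseteq> V \<rightharpoonup> x" for x
  proof -
    have "V \<sqsubseteq> x"
      using that V le_iff_join[of V V] by (simp add: le_heyting_iff)
    then show ?thesis using that V by (simp add: heyting_eq_top)
  qed
  moreover have "\<top> \<in> open_sublocale L V"
    unfolding open_sublocale_def using V by (auto intro!: image_eqI[of _ _ \<top>] simp: heyting_eq_top)
  ultimately show ?thesis
    using V by (auto simp: can_def open_sublocale_def)
qed

text \<open>The decomposition is \<open>x = (x \<squnion> U) \<sqinter> (V \<rightharpoonup> x)\<close>, with the first factor in the closed and the second in
the open sublocale.\<close>

lemma mem_sublocale_join_can_open: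
  assumes car: "x \<in> carrier L" "U \<in> carrier L" "V \<in> carrier L" and le: "(V \<rightharpoonup> x) \<sqinter> U \<sqsubseteq> x"
  shows "x \<in> sublocale_join L (can L U) (open_sublocale L V)"
proof -
  have "(x \<squnion> U) \<sqinter> (V \<rightharpoonup> x) = ((V \<rightharpoonup> x) \<sqinter> x) \<squnion> ((V \<rightharpoonup> x) \<sqinter> U)"
    using car by (subst meet_comm, subst meet_join_distrib) auto
  also have "(V \<rightharpoonup> x) \<sqinter> x = x"
    using car le_heyting[of V x] by (metis heyting_closed le_iff_join meet_comm)
  also have "x \<squnion> ((V \<rightharpoonup> x) \<sqinter> U) = x"
    using car le by (metis heyting_closed join_comm le_iff_meet meet_closed)
  finally have "x = (x \<squnion> U) \<sqinter> (V \<rightharpoonup> x)" ..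
  moreover have "x \<squnion> U \<in> can L U" using car by (auto simp: can_def join_right)
  moreover have "V \<rightharpoonup> x \<in> open_sublocale L V" using car by (auto simp: open_sublocale_def)
  ultimately show ?thesis unfolding sublocale_join_def by blast
qed

lemma sublocale_join_can_open:
  assumes V: "V \<in> carrier L"
  shows "sublocale_join L (can L V) (open_sublocale L V) = carrier L"
proof -
  have "is_sublocale L (sublocale_join L (can L V) (open_sublocale L V))"
    using V by (intro is_sublocale_join is_sublocale_can is_sublocale_open)
  then have "sublocale_join L (can L V) (open_sublocale L V) \<subseteq> carrier L"
    by (simp add: is_sublocale_def)
  then show ?thesis
    using V by (auto intro!: mem_sublocale_join_can_open heyting_meet_le)
qed

text \<open>This is the generation of the frame of sublocales by complemented elements. With \<open>j = nucleus L S\<close>,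
the sublocale \<open>can (j V) \<or> open V\<close> contains exactly the \<open>x\<close> for which \<open>(V \<rightharpoonup> x) \<sqinter> j V \<sqsubseteq> x\<close>; elements of \<open>S\<close> satisfy this for
all \<open>V\<close>, and conversely the choice \<open>V = x\<close> forces \<open>j x \<sqsubseteq> x\<close>.\<close>

lemma sublocale_eq_sup_can_open:
  assumes S: "is_sublocale L S"
  shows "S = \<Squnion>\<^bsub>sublocale_locale L\<^esub>((\<lambda>V. can L (nucleus L S V) \<sqinter>\<^bsub>sublocale_locale L\<^esub> open_sublocale L V) ` carrier L)"
proof -
  interpret S: frame_sublocale L S using S by (simp add: sublocale_iff)
  let ?J = "\<lambda>V. sublocale_join L (can L (nucleus L S V)) (open_sublocale L V)"
  have J: "(\<lambda>V. can L (nucleus L S V) \<sqinter>\<^bsub>sublocale_locale L\<^esub> open_sublocale L V) ` carrier L = ?J ` carrier L"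
    by (intro image_cong) (auto intro!: meet_sublocale_locale is_sublocale_can is_sublocale_open)
  have "\<Squnion>\<^bsub>sublocale_locale L\<^esub>(?J ` carrier L) = carrier L \<inter> (\<Inter>V\<in>carrier L. ?J V)"
    by (rule sup_sublocale_locale) (auto intro!: is_sublocale_join is_sublocale_can is_sublocale_open)
  also have "\<dots> = S"
  proof (intro equalityI subsetI)
    fix x assume x: "x \<in> S"
    have xL: "x \<in> carrier L" using x by auto
    have "x \<in> ?J V" if V: "V \<in> carrier L" for V
    proof (rule mem_sublocale_join_can_open)
      have "V \<sqsubseteq> (V \<rightharpoonup> x) \<rightharpoonup> x"
        using V xL heyting_meet_le[of V x] by (simp add: le_heyting_iff meet_comm)
      then have "nucleus L S V \<sqsubseteq> (V \<rightharpoonup> x) \<rightharpoonup> x"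
        using V x by (subst S.nucleus_le_iff) (auto intro: S.heyting_mem)
      then show "(V \<rightharpoonup> x) \<sqinter> nucleus L S V \<sqsubseteq> x"
        using xL by (simp add: le_heyting_iff meet_comm)
    qed (use xL V in auto)
    then show "x \<in> carrier L \<inter> (\<Inter>V\<in>carrier L. ?J V)" using xL by auto
  next
    fix x assume "x \<in> carrier L \<inter> (\<Inter>V\<in>carrier L. ?J V)"
    \<comment> \<open>The member of the intersection with \<open>V = x\<close> is the decisive one.\<close>
    then have x: "x \<in> carrier L" and "x \<in> ?J x" by auto
    then obtain a y where ay: "a \<in> carrier L" "nucleus L S x \<sqsubseteq> a" "y \<in> carrier L" "x = a \<sqinter> (x \<rightharpoonup> y)"
      by (auto simp: sublocale_join_def can_def open_sublocale_def)
    have "x \<sqsubseteq> x \<rightharpoonup> y" using ay by (metis heyting_closed meet_right)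
    then have "x \<sqsubseteq> y" using x ay le_iff_join[of x x] by (simp add: le_heyting_iff)
    then have "x \<rightharpoonup> y = \<top>" using x ay by (simp add: heyting_eq_top)
    then have "x = a" using ay by (metis le_iff_join top_closed top_higher)
    then have "x = nucleus L S x" using x ay S.nucleus_upper by auto
    then show "x \<in> S" by (metis S.nucleus_mem)
  qed
  finally show ?thesis unfolding J ..
qed

end

section \<open>Lifting maps from Boolean locales\<close>

context frame_hom
begin

lemma hom_carrier [simp]: "x \<in> carrier A \<Longrightarrow> h x \<in> carrier B"
  using hom_closed by auto

lemma hom_join:
  assumes "x \<in> carrier A" "y \<in> carrier A"
  shows "h (x \<squnion>\<^bsub>A\<^esub> y) = h x \<squnion>\<^bsub>B\<^esub> h y"
  using hom_sup[of "{x, y}"] assms by (simp add: join_def)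

lemma hom_bottom: "h \<bottom>\<^bsub>A\<^esub> = \<bottom>\<^bsub>B\<^esub>"
  using hom_sup[of "{}"] A.weak.weak_sup_empty B.weak.weak_sup_empty
  by (simp add: A.eq_is_equal B.eq_is_equal)

lemma hom_mono:
  assumes "x \<in> carrier A" "y \<in> carrier A" "x \<sqsubseteq>\<^bsub>A\<^esub> y"
  shows "h x \<sqsubseteq>\<^bsub>B\<^esub> h y"
  using assms hom_inf[of x y] A.le_iff_join B.le_iff_join by (metis hom_carrier)

end

locale boolean_frame = frame +
  assumes complement_exists: "x \<in> carrier L \<Longrightarrow> \<exists>y\<in>carrier L. x \<sqinter> y = \<bottom> \<and> x \<squnion> y = \<top>"
begin

definition neg :: "'a \<Rightarrow> 'a" where "neg x = x \<rightharpoonup> \<bottom>"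

lemma neg_closed [simp]: "neg x \<in> carrier L"
  by (simp add: neg_def)

lemma meet_neg: "x \<in> carrier L \<Longrightarrow> x \<sqinter> neg x = \<bottom>"
  using heyting_meet_le[of x \<bottom>] by (auto simp: neg_def meet_comm intro!: le_antisym)

lemma join_neg:
  assumes x: "x \<in> carrier L"
  shows "x \<squnion> neg x = \<top>"
proof -
  obtain y where y: "y \<in> carrier L" "x \<sqinter> y = \<bottom>" "x \<squnion> y = \<top>"
    using complement_exists[OF x] by blast
  then have "y \<sqsubseteq> neg x" using x by (simp add: neg_def le_heyting_iff meet_comm)
  then have "\<top> \<sqsubseteq> x \<squnion> neg x"
    using x y by (metis join_closed join_le join_left join_right le_trans neg_closed)
  then show ?thesis using x by (intro le_antisym) auto
qed

lemma diff_le_iff: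
  assumes "a \<in> carrier L" "b \<in> carrier L" "c \<in> carrier L"
  shows "a \<sqinter> neg b \<sqsubseteq> c \<longleftrightarrow> a \<sqsubseteq> b \<squnion> c"
proof
  assume le: "a \<sqinter> neg b \<sqsubseteq> c"
  have "a = a \<sqinter> (b \<squnion> neg b)" using assms by (simp add: join_neg)
  also have "\<dots> = (a \<sqinter> b) \<squnion> (a \<sqinter> neg b)" using assms by (intro meet_join_distrib) auto
  finally have a: "a = (a \<sqinter> b) \<squnion> (a \<sqinter> neg b)" .
  have "(a \<sqinter> b) \<squnion> (a \<sqinter> neg b) \<sqsubseteq> b \<squnion> c"
  proof (rule join_le)
    show "a \<sqinter> b \<sqsubseteq> b \<squnion> c"
      using assms by (meson join_closed join_left le_trans meet_closed meet_right)
    show "a \<sqinter> neg b \<sqsubseteq> b \<squnion> c"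
      using assms le by (meson join_closed join_right le_trans meet_closed neg_closed)
  qed (use assms in auto)
  with a show "a \<sqsubseteq> b \<squnion> c" by simp
next
  assume "a \<sqsubseteq> b \<squnion> c"
  then have "a \<sqinter> neg b \<sqsubseteq> (b \<squnion> c) \<sqinter> neg b"
    using assms by (intro meet_mono) auto
  also have "(b \<squnion> c) \<sqinter> neg b = (neg b \<sqinter> b) \<squnion> (neg b \<sqinter> c)"
    using assms by (subst meet_comm, intro meet_join_distrib) auto
  also have "neg b \<sqinter> b = \<bottom>" using assms by (subst meet_comm, intro meet_neg)
  also have "\<bottom> \<squnion> (neg b \<sqinter> c) \<sqsubseteq> c"
    using assms by (intro join_le) (auto intro: meet_right)
  finally show "a \<sqinter> neg b \<sqsubseteq> c" using assms by auto
qed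

lemma neg_meet_neg_le:
  assumes "a \<in> carrier L" "b \<in> carrier L"
  shows "neg a \<sqinter> neg b \<sqsubseteq> neg (a \<squnion> b)"
proof -
  have "(neg a \<sqinter> neg b) \<sqinter> (a \<squnion> b) = ((neg a \<sqinter> neg b) \<sqinter> a) \<squnion> ((neg a \<sqinter> neg b) \<sqinter> b)"
    using assms by (intro meet_join_distrib) auto
  also have "(neg a \<sqinter> neg b) \<sqinter> a = neg b \<sqinter> (a \<sqinter> neg a)"
    using assms by (metis meet_assoc meet_comm neg_closed)
  also have "\<dots> = \<bottom>" using assms by (auto simp: meet_neg intro!: le_antisym meet_right)
  also have "(neg a \<sqinter> neg b) \<sqinter> b = neg a \<sqinter> (b \<sqinter> neg b)"
    using assms by (metis meet_assoc meet_comm neg_closed)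
  also have "\<dots> = \<bottom>" using assms by (auto simp: meet_neg intro!: le_antisym meet_right)
  also have "\<bottom> \<squnion> \<bottom> = \<bottom>" by (auto intro!: le_antisym join_le)
  finally show ?thesis
    using assms by (simp add: neg_def[of "a \<squnion> b"] le_heyting_iff)
qed

lemma complement_eq_neg:
  assumes "x \<in> carrier L" "y \<in> carrier L" "x \<sqinter> y = \<bottom>" "x \<squnion> y = \<top>"
  shows "y = neg x"
  using assms complement_unique[of x y "neg x"] by (simp add: meet_neg join_neg)

end

locale boolean_valued_hom = frame_hom L M f + B?: boolean_frame M
  for L :: "'a gorder" (structure) and M :: "'b gorder" (structure) and f
begin

sublocale A: gorder_frame L ..

abbreviation "Sl \<equiv> sublocale_locale L"

text \<open>For \<open>j = nucleus L S\<close>, the element \<open>f (j V) \<sqinter> \<not> f V\<close> is the part of \<open>M\<close> on which \<open>f\<close> distinguishes \<open>V\<close>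
from \<open>j V\<close>. So the join is the obstruction to factoring \<open>f\<close> through \<open>S\<close>; it is the only possible
value of a lift, because \<open>S\<close> is the join of the elements \<open>can (j V) \<sqinter> open V\<close> in the frame of sublocales.\<close>

definition lift :: "'a set \<Rightarrow> 'b" where
  "lift S = \<Squnion>\<^bsub>M\<^esub>((\<lambda>V. f (nucleus L S V) \<sqinter>\<^bsub>M\<^esub> B.neg (f V)) ` carrier L)"

lemma nucleus_closed: "is_sublocale L S \<Longrightarrow> nucleus L S V \<in> carrier L"
  by (simp add: A.sublocale_iff frame_sublocale.nucleus_closed)

lemma lift_terms_subset:
  "is_sublocale L S \<Longrightarrow> (\<lambda>V. f (nucleus L S V) \<sqinter>\<^bsub>M\<^esub> B.neg (f V)) ` carrier L \<subseteq> carrier M"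
  by (auto simp: nucleus_closed)

lemma lift_closed [simp]: "is_sublocale L S \<Longrightarrow> lift S \<in> carrier M"
  unfolding lift_def by (intro B.weak.sup_closed lift_terms_subset)

text \<open>This replaces the complements in the definition by a condition involving \<open>f\<close> alone; the values of the
lift are compared through their upper bounds \<open>G\<close>.\<close>

lemma lift_le_iff:
  assumes "is_sublocale L S" "G \<in> carrier M"
  shows "lift S \<sqsubseteq>\<^bsub>M\<^esub> G \<longleftrightarrow> (\<forall>V\<in>carrier L. f (nucleus L S V) \<sqsubseteq>\<^bsub>M\<^esub> f V \<squnion>\<^bsub>M\<^esub> G)"
  unfolding lift_def using assms
  by (simp add: B.sup_le_iff[OF lift_terms_subset] B.diff_le_iff nucleus_closed)

lemma nucleus_antimono:
  assumes "is_sublocale L S" "is_sublocale L T" "S \<subseteq> T" "V \<in> carrier L"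
  shows "nucleus L T V \<sqsubseteq>\<^bsub>L\<^esub> nucleus L S V"
proof -
  interpret S: frame_sublocale L S using assms by (simp add: A.sublocale_iff)
  interpret T: frame_sublocale L T using assms by (simp add: A.sublocale_iff)
  show ?thesis
    using assms S.nucleus_mem S.nucleus_upper by (subst T.nucleus_le_iff) auto
qed

lemma lift_antimono:
  assumes "is_sublocale L S" "is_sublocale L T" "S \<subseteq> T"
  shows "lift T \<sqsubseteq>\<^bsub>M\<^esub> lift S"
proof -
  have "f (nucleus L T V) \<sqsubseteq>\<^bsub>M\<^esub> f V \<squnion>\<^bsub>M\<^esub> lift S" if V: "V \<in> carrier L" for V
  proof -
    have "f (nucleus L T V) \<sqsubseteq>\<^bsub>M\<^esub> f (nucleus L S V)"
      using assms V by (intro hom_mono nucleus_antimono nucleus_closed) auto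
    also have "f (nucleus L S V) \<sqsubseteq>\<^bsub>M\<^esub> f V \<squnion>\<^bsub>M\<^esub> lift S"
      using assms V lift_le_iff[of S "lift S"] by auto
    finally show ?thesis using assms V by (simp add: nucleus_closed)
  qed
  then show ?thesis using assms by (simp add: lift_le_iff)
qed

lemma lift_can_map:
  assumes U: "U \<in> carrier L"
  shows "lift (can L U) = f U"
proof (rule B.eq_if_same_upper)
  have S: "is_sublocale L (can L U)" using U by (rule A.is_sublocale_can)
  interpret S: frame_sublocale L "can L U" using S by (simp add: A.sublocale_iff)
  have nuc: "nucleus L (can L U) V = U \<squnion>\<^bsub>L\<^esub> V" if V: "V \<in> carrier L" for V
  proof (rule A.le_antisym)
    show "nucleus L (can L U) V \<sqsubseteq>\<^bsub>L\<^esub> U \<squnion>\<^bsub>L\<^esub> V"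
      using U V by (subst S.nucleus_le_iff) (auto simp: can_def A.weak.join_left A.weak.join_right)
    show "U \<squnion>\<^bsub>L\<^esub> V \<sqsubseteq>\<^bsub>L\<^esub> nucleus L (can L U) V"
      using U V S.nucleus_mem[of V] by (intro A.weak.join_le S.nucleus_upper) (auto simp: can_def)
  qed (use U V in auto)
  fix G assume G: "G \<in> carrier M"
  show "lift (can L U) \<sqsubseteq>\<^bsub>M\<^esub> G \<longleftrightarrow> f U \<sqsubseteq>\<^bsub>M\<^esub> G"
  proof
    assume "lift (can L U) \<sqsubseteq>\<^bsub>M\<^esub> G"
    then have "f (U \<squnion>\<^bsub>L\<^esub> \<bottom>\<^bsub>L\<^esub>) \<sqsubseteq>\<^bsub>M\<^esub> f \<bottom>\<^bsub>L\<^esub> \<squnion>\<^bsub>M\<^esub> G"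
      using nuc[of "\<bottom>\<^bsub>L\<^esub>"] lift_le_iff[OF S G] A.weak.bottom_closed by metis
    moreover have "f (U \<squnion>\<^bsub>L\<^esub> \<bottom>\<^bsub>L\<^esub>) = f U" "f \<bottom>\<^bsub>L\<^esub> \<squnion>\<^bsub>M\<^esub> G = G"
      using U G by (simp_all add: hom_bottom)
    ultimately show "f U \<sqsubseteq>\<^bsub>M\<^esub> G" by simp
  next
    assume fU: "f U \<sqsubseteq>\<^bsub>M\<^esub> G"
    have "f U \<squnion>\<^bsub>M\<^esub> f V \<sqsubseteq>\<^bsub>M\<^esub> f V \<squnion>\<^bsub>M\<^esub> G" if "V \<in> carrier L" for V
    proof (rule B.weak.join_le)
      show "f U \<sqsubseteq>\<^bsub>M\<^esub> f V \<squnion>\<^bsub>M\<^esub> G"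
        using U G that fU
        by (meson B.le_trans B.weak.join_closed B.weak.join_right hom_carrier)
    qed (use U G that in \<open>auto intro: B.weak.join_left\<close>)
    then show "lift (can L U) \<sqsubseteq>\<^bsub>M\<^esub> G"
      using S U G by (auto simp: lift_le_iff nuc hom_join)
  qed
qed (use U A.is_sublocale_can in auto)

lemma lift_top: "lift {\<top>\<^bsub>L\<^esub>} = \<top>\<^bsub>M\<^esub>"
proof -
  have S: "is_sublocale L {\<top>\<^bsub>L\<^esub>}"
    using A.Sl.top_closed by (simp add: A.top_sublocale_locale)
  interpret S: frame_sublocale L "{\<top>\<^bsub>L\<^esub>}" using S by (simp add: A.sublocale_iff)
  have "f (nucleus L {\<top>\<^bsub>L\<^esub>} \<bottom>\<^bsub>L\<^esub>) \<sqsubseteq>\<^bsub>M\<^esub> f \<bottom>\<^bsub>L\<^esub> \<squnion>\<^bsub>M\<^esub> lift {\<top>\<^bsub>L\<^esub>}"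
    using lift_le_iff[OF S lift_closed[OF S]] S by auto
  moreover have "nucleus L {\<top>\<^bsub>L\<^esub>} \<bottom>\<^bsub>L\<^esub> = \<top>\<^bsub>L\<^esub>"
    using S.nucleus_mem by blast
  moreover have "f \<bottom>\<^bsub>L\<^esub> \<squnion>\<^bsub>M\<^esub> lift {\<top>\<^bsub>L\<^esub>} = lift {\<top>\<^bsub>L\<^esub>}"
    using S by (simp add: hom_bottom)
  ultimately show ?thesis using S by (intro B.le_antisym) (auto simp: hom_top)
qed

text \<open>Fix \<open>G\<close> above \<open>lift S\<close> for all \<open>S \<in> \<A>\<close>, and let \<open>r\<close> be the largest element with \<open>f r \<sqsubseteq> f V \<squnion> G\<close>. For
each such \<open>S\<close> the closure of \<open>r\<close> in \<open>S\<close> satisfies the same inequality and so equals \<open>r\<close>. Thus \<open>r\<close> lies in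
the intersection and bounds the closure of \<open>V\<close> there, although closures with respect to an intersection
have no direct description in terms of those of its members.\<close>

lemma lift_Inter:
  assumes \<A>: "\<And>S. S \<in> \<A> \<Longrightarrow> is_sublocale L S"
  shows "lift (carrier L \<inter> \<Inter>\<A>) = \<Squnion>\<^bsub>M\<^esub>(lift ` \<A>)"
proof (rule B.eq_if_same_upper)
  let ?T = "carrier L \<inter> \<Inter>\<A>"
  have T: "is_sublocale L ?T" using \<A> by (rule A.is_sublocale_Inter)
  interpret T: frame_sublocale L ?T using T by (simp add: A.sublocale_iff)
  have img: "lift ` \<A> \<subseteq> carrier M" using \<A> by auto
  show "lift ?T \<in> carrier M" using T by simp
  show "\<Squnion>\<^bsub>M\<^esub>(lift ` \<A>) \<in> carrier M" using img by simp
  fix G assume G: "G \<in> carrier M"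
  show "lift ?T \<sqsubseteq>\<^bsub>M\<^esub> G \<longleftrightarrow> \<Squnion>\<^bsub>M\<^esub>(lift ` \<A>) \<sqsubseteq>\<^bsub>M\<^esub> G"
  proof
    assume le: "lift ?T \<sqsubseteq>\<^bsub>M\<^esub> G"
    have "lift S \<sqsubseteq>\<^bsub>M\<^esub> G" if "S \<in> \<A>" for S
      using \<A>[OF that] T that G le lift_antimono[of ?T S]
      by (meson B.le_trans Inter_lower inf.coboundedI2 lift_closed)
    then show "\<Squnion>\<^bsub>M\<^esub>(lift ` \<A>) \<sqsubseteq>\<^bsub>M\<^esub> G"
      using img G by (auto simp: B.sup_le_iff)
  next
    assume "\<Squnion>\<^bsub>M\<^esub>(lift ` \<A>) \<sqsubseteq>\<^bsub>M\<^esub> G"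
    then have le: "f (nucleus L S V) \<sqsubseteq>\<^bsub>M\<^esub> f V \<squnion>\<^bsub>M\<^esub> G" if "S \<in> \<A>" "V \<in> carrier L" for S V
      using that img G \<A> by (auto simp: B.sup_le_iff lift_le_iff)
    have "f (nucleus L ?T V) \<sqsubseteq>\<^bsub>M\<^esub> f V \<squnion>\<^bsub>M\<^esub> G" if V: "V \<in> carrier L" for V
    proof -
      let ?R = "{V' \<in> carrier L. f V' \<sqsubseteq>\<^bsub>M\<^esub> f V \<squnion>\<^bsub>M\<^esub> G}"
      define r where "r = \<Squnion>\<^bsub>L\<^esub>?R"
      have R: "?R \<subseteq> carrier L" by auto
      have r: "r \<in> carrier L" unfolding r_def using R by simp
      have fr: "f r \<sqsubseteq>\<^bsub>M\<^esub> f V \<squnion>\<^bsub>M\<^esub> G"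
        unfolding r_def hom_sup[OF R] using V G by (intro B.weak.sup_least) auto
      have "r \<in> S" if S: "S \<in> \<A>" for S
      proof -
        interpret S: frame_sublocale L S using \<A>[OF S] by (simp add: A.sublocale_iff)
        have "f (nucleus L S r) \<sqsubseteq>\<^bsub>M\<^esub> f r \<squnion>\<^bsub>M\<^esub> G" using le S r by blast
        also have "f r \<squnion>\<^bsub>M\<^esub> G \<sqsubseteq>\<^bsub>M\<^esub> f V \<squnion>\<^bsub>M\<^esub> G"
          using fr V G r by (intro B.weak.join_le) (auto intro: B.weak.join_right)
        finally have "f (nucleus L S r) \<sqsubseteq>\<^bsub>M\<^esub> f V \<squnion>\<^bsub>M\<^esub> G" using V G r by simp
        then have "nucleus L S r \<sqsubseteq>\<^bsub>L\<^esub> r"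
          unfolding r_def using R by (intro A.weak.sup_upper) auto
        then have "nucleus L S r = r"
          using r by (intro A.le_antisym S.nucleus_upper) auto
        then show ?thesis by (metis S.nucleus_mem)
      qed
      then have rT: "r \<in> ?T" using r by auto
      have "V \<sqsubseteq>\<^bsub>L\<^esub> r"
        unfolding r_def using R V G by (intro A.weak.sup_upper) (auto intro: B.weak.join_left)
      then have "nucleus L ?T V \<sqsubseteq>\<^bsub>L\<^esub> r"
        using V rT by (subst T.nucleus_le_iff) auto
      then have "f (nucleus L ?T V) \<sqsubseteq>\<^bsub>M\<^esub> f r"
        using r by (intro hom_mono) auto
      then show ?thesis using fr V G r by (meson B.weak.join_closed B.le_trans T.nucleus_closed hom_carrier)
    qed
    then show "lift ?T \<sqsubseteq>\<^bsub>M\<^esub> G" using T G by (simp add: lift_le_iff)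
  qed
qed

text \<open>The obstructions for \<open>V\<close> in \<open>S\<close> and for \<open>V'\<close> in \<open>T\<close> meet in part of the obstruction for \<open>V \<squnion> V'\<close> in the join,
since the closure of \<open>V \<squnion> V'\<close> in the join lies above the closure of \<open>V\<close> in \<open>S\<close> met with that of \<open>V'\<close> in \<open>T\<close>.\<close>

lemma lift_join:
  assumes S: "is_sublocale L S" and T: "is_sublocale L T"
  shows "lift (sublocale_join L S T) = lift S \<sqinter>\<^bsub>M\<^esub> lift T"
proof (rule B.le_antisym)
  let ?J = "sublocale_join L S T"
  have J: "is_sublocale L ?J" using S T by (rule A.is_sublocale_join)
  interpret S: frame_sublocale L S using S by (simp add: A.sublocale_iff)
  interpret T: frame_sublocale L T using T by (simp add: A.sublocale_iff)
  interpret J: frame_sublocale L ?J using J by (simp add: A.sublocale_iff)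
  show "lift ?J \<sqsubseteq>\<^bsub>M\<^esub> lift S \<sqinter>\<^bsub>M\<^esub> lift T"
    using S T J A.subset_sublocale_join[OF S T] by (intro B.weak.meet_le lift_antimono) auto
  let ?a = "\<lambda>S V. f (nucleus L S V) \<sqinter>\<^bsub>M\<^esub> B.neg (f V)"
  have a: "?a S V \<in> carrier M" "?a T V \<in> carrier M" "?a ?J V \<in> carrier M" if "V \<in> carrier L" for V
    using that by auto
  have key: "?a S V \<sqinter>\<^bsub>M\<^esub> ?a T V' \<sqsubseteq>\<^bsub>M\<^esub> lift ?J" if V: "V \<in> carrier L" "V' \<in> carrier L" for V V'
  proof -
    let ?W = "V \<squnion>\<^bsub>L\<^esub> V'"
    have W: "?W \<in> carrier L" using V by simp
    have "nucleus L S V \<sqinter>\<^bsub>L\<^esub> nucleus L T V' \<sqsubseteq>\<^bsub>L\<^esub> nucleus L ?J ?W"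
    proof -
      obtain s t where st: "s \<in> S" "t \<in> T" "nucleus L ?J ?W = s \<sqinter>\<^bsub>L\<^esub> t"
        using J.nucleus_mem[of ?W] unfolding sublocale_join_def by blast
      then have car: "s \<in> carrier L" "t \<in> carrier L" by auto
      have "?W \<sqsubseteq>\<^bsub>L\<^esub> s \<sqinter>\<^bsub>L\<^esub> t" using J.nucleus_upper[OF W] st by simp
      then have "V \<sqsubseteq>\<^bsub>L\<^esub> s" "V' \<sqsubseteq>\<^bsub>L\<^esub> t"
        using V car by (auto simp: A.join_le_iff A.le_meet_iff)
      then show ?thesis
        unfolding st(3) using V st car
        by (intro A.meet_mono) (auto simp: S.nucleus_le_iff T.nucleus_le_iff)
    qed
    then have 1: "f (nucleus L S V) \<sqinter>\<^bsub>M\<^esub> f (nucleus L T V') \<sqsubseteq>\<^bsub>M\<^esub> f (nucleus L ?J ?W)"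
      using hom_mono[of "nucleus L S V \<sqinter>\<^bsub>L\<^esub> nucleus L T V'"] by (simp add: hom_inf)
    have 2: "B.neg (f V) \<sqinter>\<^bsub>M\<^esub> B.neg (f V') \<sqsubseteq>\<^bsub>M\<^esub> B.neg (f ?W)"
      using V by (simp add: hom_join B.neg_meet_neg_le)
    have "?a S V \<sqinter>\<^bsub>M\<^esub> ?a T V' = (f (nucleus L S V) \<sqinter>\<^bsub>M\<^esub> f (nucleus L T V')) \<sqinter>\<^bsub>M\<^esub> (B.neg (f V) \<sqinter>\<^bsub>M\<^esub> B.neg (f V'))"
      using V by (smt (verit) B.meet_assoc B.weak.meet_closed B.neg_closed S.nucleus_closed T.nucleus_closed hom_carrier meet_comm)
    also have "\<dots> \<sqsubseteq>\<^bsub>M\<^esub> ?a ?J ?W"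
      using V W 1 2 by (intro B.meet_mono) auto
    finally have "?a S V \<sqinter>\<^bsub>M\<^esub> ?a T V' \<sqsubseteq>\<^bsub>M\<^esub> ?a ?J ?W" .
    moreover have "?a ?J ?W \<sqsubseteq>\<^bsub>M\<^esub> lift ?J"
      unfolding lift_def using W by (intro B.weak.sup_upper lift_terms_subset J) auto
    ultimately show ?thesis
      using V W J by (meson B.le_trans B.weak.meet_closed a lift_closed)
  qed
  have "lift S \<sqinter>\<^bsub>M\<^esub> ?a T V' \<sqsubseteq>\<^bsub>M\<^esub> lift ?J" if V': "V' \<in> carrier L" for V'
    unfolding lift_def[of S] B.meet_sup_distrib[OF a(2)[OF V'] lift_terms_subset[OF S]]
    using key V' J by (intro B.weak.sup_least) auto
  then have "lift S \<sqinter>\<^bsub>M\<^esub> lift T \<sqsubseteq>\<^bsub>M\<^esub> lift ?J"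
    unfolding lift_def[of T] B.inf_sup_distrib[OF lift_closed[OF S] lift_terms_subset[OF T]]
    using J S by (intro B.weak.sup_least) auto
  then show "lift S \<sqinter>\<^bsub>M\<^esub> lift T \<sqsubseteq>\<^bsub>M\<^esub> lift ?J" .
qed (use S T A.is_sublocale_join in auto)

abbreviation "ext_lift \<equiv> restrict lift {S. is_sublocale L S}"

lemma frame_hom_lift: "frame_hom Sl M ext_lift"
proof -
  interpret Sl: frame Sl by (rule A.frame_sublocale_locale)
  show ?thesis
  proof
    show "ext_lift \<in> carrier Sl \<rightarrow> carrier M" by auto
    show "ext_lift (\<Squnion>\<^bsub>Sl\<^esub>\<A>) = \<Squnion>\<^bsub>M\<^esub>(ext_lift ` \<A>)" if "\<A> \<subseteq> carrier Sl" for \<A>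
    proof -
      have \<A>: "is_sublocale L S" if "S \<in> \<A>" for S using \<open>\<A> \<subseteq> carrier Sl\<close> that by auto
      have "ext_lift ` \<A> = lift ` \<A>" using \<A> by (intro image_cong) auto
      moreover have "\<Squnion>\<^bsub>Sl\<^esub>\<A> = carrier L \<inter> \<Inter>\<A>"
        using that by (intro A.sup_sublocale_locale) auto
      ultimately show ?thesis
        using A.is_sublocale_Inter[OF \<A>] lift_Inter[OF \<A>] by simp
    qed
    show "ext_lift \<top>\<^bsub>Sl\<^esub> = \<top>\<^bsub>M\<^esub>"
      using A.Sl.top_closed lift_top by (simp add: A.top_sublocale_locale)
    show "ext_lift (S \<sqinter>\<^bsub>Sl\<^esub> T) = ext_lift S \<sqinter>\<^bsub>M\<^esub> ext_lift T"
      if "S \<in> carrier Sl" "T \<in> carrier Sl" for S T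
      using that by (simp add: A.meet_sublocale_locale A.is_sublocale_join lift_join)
  qed
qed

text \<open>Homomorphisms preserve complements, which determines \<open>g\<close> on open sublocales; the closed and open
sublocales generate.\<close>

lemma hom_extending_eq_lift:
  assumes g: "frame_hom Sl M g" and gcan: "\<And>U. U \<in> carrier L \<Longrightarrow> g (can L U) = f U"
  shows open_hom_eq_neg: "V \<in> carrier L \<Longrightarrow> g (open_sublocale L V) = B.neg (f V)"
    and "is_sublocale L S \<Longrightarrow> g S = lift S"
proof -
  interpret g: frame_hom Sl M g by fact
  have opn: "g (open_sublocale L V) = B.neg (f V)" if V: "V \<in> carrier L" for V
  proof (rule B.complement_eq_neg)
    have c: "is_sublocale L (can L V)" "is_sublocale L (open_sublocale L V)"
      using V by (auto intro: A.is_sublocale_can A.is_sublocale_open)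
    show "f V \<in> carrier M" "g (open_sublocale L V) \<in> carrier M"
      using V c by auto
    have "f V \<sqinter>\<^bsub>M\<^esub> g (open_sublocale L V) = g (can L V \<sqinter>\<^bsub>Sl\<^esub> open_sublocale L V)"
      using g.hom_inf[of "can L V" "open_sublocale L V"] V c gcan by simp
    also have "can L V \<sqinter>\<^bsub>Sl\<^esub> open_sublocale L V = \<bottom>\<^bsub>Sl\<^esub>"
      unfolding A.meet_sublocale_locale[OF c] A.bottom_sublocale_locale
      using V by (rule A.sublocale_join_can_open)
    finally show "f V \<sqinter>\<^bsub>M\<^esub> g (open_sublocale L V) = \<bottom>\<^bsub>M\<^esub>" unfolding g.hom_bottom .
    have "f V \<squnion>\<^bsub>M\<^esub> g (open_sublocale L V) = g (can L V \<squnion>\<^bsub>Sl\<^esub> open_sublocale L V)"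
      using g.hom_join[of "can L V" "open_sublocale L V"] V c gcan by simp
    also have "can L V \<squnion>\<^bsub>Sl\<^esub> open_sublocale L V = \<top>\<^bsub>Sl\<^esub>"
      unfolding A.join_sublocale_locale[OF c] A.top_sublocale_locale
      using V by (rule A.can_Int_open)
    finally show "f V \<squnion>\<^bsub>M\<^esub> g (open_sublocale L V) = \<top>\<^bsub>M\<^esub>" unfolding g.hom_top .
  qed
  then show "V \<in> carrier L \<Longrightarrow> g (open_sublocale L V) = B.neg (f V)" .
  assume S: "is_sublocale L S"
  have c: "is_sublocale L (can L (nucleus L S V))" "is_sublocale L (open_sublocale L V)"
    if "V \<in> carrier L" for V
    using that S by (auto intro: A.is_sublocale_can A.is_sublocale_open nucleus_closed)
  let ?m = "\<lambda>V. can L (nucleus L S V) \<sqinter>\<^bsub>Sl\<^esub> open_sublocale L V"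
  have "g S = g (\<Squnion>\<^bsub>Sl\<^esub>(?m ` carrier L))"
    using A.sublocale_eq_sup_can_open[OF S] by simp
  also have "\<dots> = \<Squnion>\<^bsub>M\<^esub>(g ` ?m ` carrier L)"
    using c by (intro g.hom_sup) (auto simp: A.meet_sublocale_locale A.is_sublocale_join)
  also have "g ` ?m ` carrier L = (\<lambda>V. f (nucleus L S V) \<sqinter>\<^bsub>M\<^esub> B.neg (f V)) ` carrier L"
    unfolding image_image
    using c S by (intro image_cong) (auto simp: g.hom_inf gcan opn nucleus_closed )
  finally show "g S = lift S" by (simp add: lift_def)
qed

lemma lift_can_eq_lift:
  assumes "f \<in> extensional (carrier L)"
  shows "lift_can M L f = ext_lift"
  unfolding lift_can_def
proof (rule the_equality)
  show "ext_lift \<in> locale_maps M Sl \<and> compose (carrier L) ext_lift (can L) = f"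
    using assms frame_hom_lift
    by (auto simp: locale_maps_def compose_def fun_eq_iff extensional_def lift_can_map A.is_sublocale_can)
  fix g assume g: "g \<in> locale_maps M Sl \<and> compose (carrier L) g (can L) = f"
  then have "g (can L U) = f U" if "U \<in> carrier L" for U
    using g that compose_eq[of U "carrier L" g "can L"] by auto
  then have "g S = lift S" if "is_sublocale L S" for S
    using hom_extending_eq_lift(2)[of g] g that by (auto simp: locale_maps_def)
  then show "g = ext_lift"
    using g by (auto simp: locale_maps_def extensional_def fun_eq_iff)
qed

end

section \<open>Regular contents\<close>

locale hausdorff_content = regular_content X lam for X :: "'a topology" and lam :: "'a set \<Rightarrow> real" +
  assumes Hausdorff: "Hausdorff_space X"
begin

lemma compact_closed: "compactin X C \<Longrightarrow> closedin X C"
  using Hausdorff by (rule compactin_imp_closedin)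

lemma compact_Int: "\<lbrakk>compactin X C; compactin X D\<rbrakk> \<Longrightarrow> compactin X (C \<inter> D)"
  by (simp add: closed_Int_compactin compact_closed)

lemma compact_diff:
  assumes C: "compactin X C" and V: "openin X V"
  shows "compactin X (C - V)"
proof -
  have "C - V = (topspace X - V) \<inter> C"
    using compactin_subset_topspace[OF C] by auto
  then show ?thesis
    using closed_Int_compactin[OF _ C, of "topspace X - V"] V by (simp add: closedin_diff)
qed

lemma compact_Union: "\<lbrakk>finite \<F>; \<And>C. C \<in> \<F> \<Longrightarrow> compactin X C\<rbrakk> \<Longrightarrow> compactin X (\<Union>\<F>)"
  by (rule compactin_Union) auto

lemma lam_empty: "lam {} = 0"
  using additive[of "{}" "{}"] by simp

lemma nbhd_approx:
  assumes C: "compactin X C" and e: "0 < \<epsilon>"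
  obtains V K where "openin X V" "compactin X K" "C \<subseteq> V" "V \<subseteq> K" "lam K < lam C + \<epsilon>"
proof -
  have "ennreal (lam C) < ennreal (lam C + \<epsilon>)"
    using nonneg[OF C] e by (simp add: ennreal_lessI)
  then obtain K where K: "compactin X K" "way_inside X C K" "ennreal (lam K) < ennreal (lam C + \<epsilon>)"
    unfolding regular[OF C] by (auto simp: INF_less_iff)
  then have "lam K < lam C + \<epsilon>"
    using nonneg by (simp add: ennreal_less_iff)
  with K show ?thesis using that by (auto simp: way_inside_def)
qed

text \<open>Remove a neighbourhood \<open>V\<close> of \<open>C \<inter> D\<close>, contained in a compact \<open>E\<close> of content close to that of \<open>C \<inter> D\<close>.
What remains of \<open>C\<close> and \<open>D\<close> is disjoint, so contents add, and for each of the sets \<open>C\<close>, \<open>D\<close>, \<open>C \<union> D\<close> the part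
removed accounts for the content of \<open>C \<inter> D\<close> up to \<open>\<epsilon>\<close>.\<close>

lemma modular:
  assumes C: "compactin X C" and D: "compactin X D"
  shows "lam C + lam D = lam (C \<union> D) + lam (C \<inter> D)"
proof -
  have CD: "compactin X (C \<union> D)" "compactin X (C \<inter> D)"
    using C D by (auto intro: compactin_Un compact_Int)
  have "lam C + lam D \<le> lam (C \<union> D) + lam (C \<inter> D) + 2 * \<epsilon> \<and> lam (C \<union> D) + lam (C \<inter> D) \<le> lam C + lam D + 2 * \<epsilon>"
    if e: "0 < \<epsilon>" for \<epsilon>
  proof -
    obtain V E where V: "openin X V" "compactin X E" "C \<inter> D \<subseteq> V" "V \<subseteq> E" "lam E < lam (C \<inter> D) + \<epsilon>"
      using nbhd_approx[OF CD(2) e] .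
    have cp: "compactin X (C - V)" "compactin X (D - V)" "compactin X (C \<union> D - V)"
      using C D CD V by (auto intro: compact_diff)
    have "C \<union> D - V = (C - V) \<union> (D - V)" "(C - V) \<inter> (D - V) = {}" using V by auto
    then have split: "lam (C \<union> D - V) = lam (C - V) + lam (D - V)"
      using additive cp by metis
    have inner: "lam (K - V) + lam (C \<inter> D) \<le> lam K" if "compactin X K" "C \<inter> D \<subseteq> K" for K
    proof -
      have "lam (K - V) + lam (C \<inter> D) = lam ((K - V) \<union> (C \<inter> D))"
        using V that CD by (intro additive[symmetric] compact_diff) auto
      also have "\<dots> \<le> lam K"
        using V that CD by (intro mono compactin_Un compact_diff) auto
      finally show ?thesis .
    qed
    have outer: "lam K \<le> lam (K - V) + lam E" if "compactin X K" for K
    proof -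
      have "lam K \<le> lam ((K - V) \<union> E)"
        using V that by (intro mono compactin_Un compact_diff) auto
      also have "\<dots> \<le> lam (K - V) + lam E"
        using V that by (intro subadditive compact_diff)
      finally show ?thesis .
    qed
    show ?thesis
      using inner[OF C] inner[OF D] inner[OF CD(1)] Un_upper1[of C D] outer[OF C] outer[OF D] outer[OF CD(1)] split V(5)
      by (simp add: le_infI1)
  qed
  then have "\<And>\<epsilon>. 0 < \<epsilon> \<Longrightarrow> lam C + lam D \<le> lam (C \<union> D) + lam (C \<inter> D) + \<epsilon>"
    "\<And>\<epsilon>. 0 < \<epsilon> \<Longrightarrow> lam (C \<union> D) + lam (C \<inter> D) \<le> lam C + lam D + \<epsilon>"
    by (metis field_sum_of_halves half_gt_zero mult_2)+
  then show ?thesis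
    by (metis antisym field_le_epsilon)
qed

text \<open>By modularity the defect \<open>lam K - lam C\<close> of a compact subset \<open>C \<subseteq> K\<close> behaves like the measure of \<open>K - C\<close>: it
is subadditive for unions and decreases under restriction to a smaller compact set.\<close>

lemma defect_Un:
  assumes "compactin X K" "compactin X K'" "compactin X C" "compactin X C'" "C \<subseteq> K" "C' \<subseteq> K'"
  shows "lam (K \<union> K') - lam (C \<union> C') \<le> (lam K - lam C) + (lam K' - lam C')"
proof -
  have "lam (C \<inter> C') \<le> lam (K \<inter> K')"
    using assms by (intro mono compact_Int) auto
  then show ?thesis using modular[of K K'] modular[of C C'] assms by linarith
qed

lemma defect_UN:
  assumes "finite I" "\<And>i. i \<in> I \<Longrightarrow> compactin X (K i) \<and> compactin X (C i) \<and> C i \<subseteq> K i"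
  shows "lam (\<Union>i\<in>I. K i) - lam (\<Union>i\<in>I. C i) \<le> (\<Sum>i\<in>I. lam (K i) - lam (C i))"
  using assms
proof (induction I)
  case (insert j I)
  have car: "compactin X (K i)" "compactin X (C i)" "C i \<subseteq> K i" if "i \<in> insert j I" for i
    using insert.prems that by auto
  have Un: "compactin X (\<Union>i\<in>I. K i)" "compactin X (\<Union>i\<in>I. C i)" "(\<Union>i\<in>I. C i) \<subseteq> (\<Union>i\<in>I. K i)"
    using insert.hyps(1) car by (auto intro!: compact_Union) (use car in blast)
  have "lam (K j \<union> (\<Union>i\<in>I. K i)) - lam (C j \<union> (\<Union>i\<in>I. C i))
      \<le> (lam (K j) - lam (C j)) + (lam (\<Union>i\<in>I. K i) - lam (\<Union>i\<in>I. C i))"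
    using car Un by (intro defect_Un) auto
  moreover have "lam (\<Union>i\<in>I. K i) - lam (\<Union>i\<in>I. C i) \<le> (\<Sum>i\<in>I. lam (K i) - lam (C i))"
    using insert.prems by (intro insert.IH) auto
  ultimately show ?case using insert.hyps by simp
qed simp

lemma defect_Int:
  assumes "compactin X K" "compactin X C" "compactin X D" "C \<subseteq> K" "D \<subseteq> K"
  shows "lam D - lam (D \<inter> C) \<le> lam K - lam C"
proof -
  have "lam (D \<union> C) \<le> lam K" using assms by (intro mono compactin_Un) auto
  then show ?thesis using modular[of D C] assms by linarith
qed

lemma lam_null_UN:
  assumes "finite \<F>" "\<And>C. C \<in> \<F> \<Longrightarrow> compactin X C \<and> lam C = 0"
  shows "lam (\<Union>\<F>) = 0"
proof -
  have "lam (\<Union>C\<in>\<F>. C) - lam (\<Union>C\<in>\<F>. {}) \<le> (\<Sum>C\<in>\<F>. lam C - lam {})"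
    using assms by (intro defect_UN) auto
  also have "\<dots> = 0" using assms by (intro sum.neutral) (simp add: lam_empty)
  finally have "lam (\<Union>\<F>) \<le> 0" by (simp add: lam_empty)
  moreover have "0 \<le> lam (\<Union>\<F>)" using assms by (intro nonneg compact_Union) auto
  ultimately show ?thesis by simp
qed

section \<open>Approximation by ideals of compact sets\<close>

definition compacts :: "'a set set" where "compacts = {K. compactin X K}"

definition compact_ideal :: "'a set set \<Rightarrow> bool" where
  "compact_ideal I \<longleftrightarrow> I \<subseteq> compacts \<and> {} \<in> I \<and>
     (\<forall>K\<in>I. \<forall>C. compactin X C \<and> C \<subseteq> K \<longrightarrow> C \<in> I) \<and> (\<forall>C\<in>I. \<forall>D\<in>I. C \<union> D \<in> I)"

text \<open>Approximation by a single member suffices here, since the ideals of interest are closed under finite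
unions. For these, \<open>approx I\<close> is the \<open>\<lambda>\<close>-ideal generated by \<open>I\<close>.\<close>

definition approx :: "'a set set \<Rightarrow> 'a set set" where
  "approx I = {K. compactin X K \<and> (\<forall>\<epsilon>>0. \<exists>C\<in>I. C \<subseteq> K \<and> lam K - lam C < \<epsilon>)}"

lemma compact_ideal_Union:
  assumes "compact_ideal I" "finite \<F>" "\<F> \<subseteq> I"
  shows "\<Union>\<F> \<in> I"
  using assms(2,3) by (induction \<F>) (use assms(1) in \<open>auto simp: compact_ideal_def\<close>)

text \<open>A finite union of members is approximated by itself, without defect.\<close>

lemma content_ideal_imp_compact_ideal:
  assumes U: "content_ideal X lam U"
  shows "compact_ideal U"
proof -
  have join: "K \<in> U" if "compactin X K" "finite \<F>" "\<F> \<subseteq> U" "K = \<Union>\<F>" for K \<F>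
  proof -
    have "\<forall>\<epsilon>>0. \<exists>\<F>'. finite \<F>' \<and> \<F>' \<subseteq> \<F> \<and> lam K - lam (\<Union>\<F>') < \<epsilon>"
      using that by (intro allI impI exI[of _ \<F>]) auto
    then show ?thesis
      using U that unfolding content_ideal_def by blast
  qed
  have comp: "compactin X K" if "K \<in> U" for K
    using U that by (auto simp: content_ideal_def)
  show ?thesis
    unfolding compact_ideal_def
  proof (intro conjI ballI)
    show "{} \<in> U" by (rule join[of _ "{}"]) auto
    show "C \<union> D \<in> U" if "C \<in> U" "D \<in> U" for C D
      using that comp by (intro join[of _ "{C, D}"]) (auto intro: compactin_Un)
  qed (use U in \<open>auto simp: content_ideal_def compacts_def\<close>)
qed

lemma subset_approx:
  assumes "compact_ideal I" shows "I \<subseteq> approx I"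
  using assms by (auto simp: approx_def compact_ideal_def compacts_def)

lemma approxE:
  assumes "K \<in> approx I" "0 < \<epsilon>"
  obtains C where "C \<in> I" "C \<subseteq> K" "lam K - lam C < \<epsilon>"
  using assms unfolding approx_def by blast

lemma approx_mono: "I \<subseteq> J \<Longrightarrow> approx I \<subseteq> approx J"
  unfolding approx_def by blast

lemma approx_least:
  assumes U: "content_ideal X lam U" and "I \<subseteq> U"
  shows "approx I \<subseteq> U"
proof
  fix K assume K: "K \<in> approx I"
  have "\<exists>\<F>. finite \<F> \<and> \<F> \<subseteq> {C \<in> I. C \<subseteq> K} \<and> lam K - lam (\<Union>\<F>) < \<epsilon>" if e: "0 < \<epsilon>" for \<epsilon>
  proof -
    obtain C where "C \<in> I" "C \<subseteq> K" "lam K - lam C < \<epsilon>"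
      using K e by (auto simp: approx_def)
    then show ?thesis by (intro exI[of _ "{C}"]) auto
  qed
  moreover have "compactin X K" using K by (simp add: approx_def)
  moreover have "{C \<in> I. C \<subseteq> K} \<subseteq> U" using \<open>I \<subseteq> U\<close> by auto
  ultimately show "K \<in> U"
    using U unfolding content_ideal_def by (metis (no_types, lifting) mem_Collect_eq)
qed

text \<open>Approximations restrict to smaller compact sets and combine to approximations of unions, by the two
estimates for defects.\<close>

lemma compact_ideal_approx:
  assumes I: "compact_ideal I"
  shows "compact_ideal (approx I)"
  unfolding compact_ideal_def
proof (intro conjI ballI allI impI)
  have comp: "compactin X K" if "K \<in> I" for K
    using I that by (auto simp: compact_ideal_def compacts_def)
  show "approx I \<subseteq> compacts" by (auto simp: approx_def compacts_def)
  show "{} \<in> approx I" using I subset_approx by (auto simp: compact_ideal_def)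
  fix K assume K: "K \<in> approx I"
  then have Kc: "compactin X K" by (simp add: approx_def)
  show "D \<in> approx I" if D: "compactin X D \<and> D \<subseteq> K" for D
  proof -
    have "\<exists>C\<in>I. C \<subseteq> D \<and> lam D - lam C < \<epsilon>" if e: "0 < \<epsilon>" for \<epsilon>
    proof -
      obtain C where C: "C \<in> I" "C \<subseteq> K" "lam K - lam C < \<epsilon>"
        using K e by (rule approxE)
      have "compactin X (D \<inter> C)" using C D comp by (auto intro: compact_Int)
      then have "D \<inter> C \<in> I" using C(1) I by (auto simp: compact_ideal_def)
      moreover have "lam D - lam (D \<inter> C) < \<epsilon>"
        using defect_Int[of K C D] C D Kc comp by force
      ultimately show ?thesis by (intro bexI[of _ "D \<inter> C"]) auto
    qed
    then show ?thesis using D by (simp add: approx_def)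
  qed
  fix K' assume K': "K' \<in> approx I"
  then have K'c: "compactin X K'" by (simp add: approx_def)
  have "\<exists>C\<in>I. C \<subseteq> K \<union> K' \<and> lam (K \<union> K') - lam C < \<epsilon>" if e: "0 < \<epsilon>" for \<epsilon>
  proof -
    have e2: "0 < \<epsilon> / 2" using e by simp
    obtain C where C: "C \<in> I" "C \<subseteq> K" "lam K - lam C < \<epsilon> / 2"
      using K e2 by (rule approxE)
    obtain C' where C': "C' \<in> I" "C' \<subseteq> K'" "lam K' - lam C' < \<epsilon> / 2"
      using K' e2 by (rule approxE)
    have "lam (K \<union> K') - lam (C \<union> C') < \<epsilon>"
      using defect_Un[OF Kc K'c comp[OF C(1)] comp[OF C'(1)] C(2) C'(2)] C(3) C'(3) by linarith
    moreover have "C \<union> C' \<in> I" using I C C' by (auto simp: compact_ideal_def)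
    ultimately show ?thesis using C C' by (intro bexI[of _ "C \<union> C'"]) auto
  qed
  then show "K \<union> K' \<in> approx I" using Kc K'c by (simp add: approx_def compactin_Un)
qed

lemma content_ideal_approx:
  assumes I: "compact_ideal I"
  shows "content_ideal X lam (approx I)"
  unfolding content_ideal_def
proof (intro conjI allI impI)
  note ideal = compact_ideal_approx[OF I]
  show "approx I \<subseteq> {K. compactin X K}" by (auto simp: approx_def)
  show "\<forall>K\<in>approx I. \<forall>C. compactin X C \<and> C \<subseteq> K \<longrightarrow> C \<in> approx I"
    using ideal by (simp add: compact_ideal_def)
  fix K \<A>
  assume A: "compactin X K \<and> \<A> \<subseteq> approx I \<and> (\<forall>C\<in>\<A>. C \<subseteq> K) \<and>
      (\<forall>\<epsilon>>0. \<exists>\<F>. finite \<F> \<and> \<F> \<subseteq> \<A> \<and> lam K - lam (\<Union>\<F>) < \<epsilon>)"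
  have "\<exists>C\<in>I. C \<subseteq> K \<and> lam K - lam C < \<epsilon>" if "0 < \<epsilon>" for \<epsilon>
  proof -
    have e2: "0 < \<epsilon> / 2" using that by simp
    then obtain \<F> where F: "finite \<F>" "\<F> \<subseteq> \<A>" "lam K - lam (\<Union>\<F>) < \<epsilon> / 2"
      using A by blast
    have "\<Union>\<F> \<in> approx I" using F A by (intro compact_ideal_Union[OF ideal]) auto
    then obtain C where C: "C \<in> I" "C \<subseteq> \<Union>\<F>" "lam (\<Union>\<F>) - lam C < \<epsilon> / 2"
      using e2 by (rule approxE)
    have "C \<subseteq> K" using C F A by blast
    then show ?thesis using C F by (intro bexI[of _ C]) auto
  qed
  then show "K \<in> approx I" using A by (simp add: approx_def)
qed

lemma hull_eq_approx:
  assumes "compact_ideal I"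
  shows "content_ideal X lam hull I = approx I"
  using assms by (intro hull_unique subset_approx content_ideal_approx approx_least) auto

text \<open>Two approximations of \<open>K\<close> intersect in an approximation whose defect is at most the sum of theirs.\<close>

lemma approx_Int:
  assumes I: "compact_ideal I" and J: "compact_ideal J"
  shows "approx (I \<inter> J) = approx I \<inter> approx J"
proof (intro equalityI subsetI)
  fix K assume K: "K \<in> approx I \<inter> approx J"
  then have KI: "K \<in> approx I" and KJ: "K \<in> approx J" and Kc: "compactin X K"
    by (simp_all add: approx_def)
  have "\<exists>C\<in>I \<inter> J. C \<subseteq> K \<and> lam K - lam C < \<epsilon>" if "0 < \<epsilon>" for \<epsilon>
  proof -
    have e2: "0 < \<epsilon> / 2" using that by simp
    obtain C where C: "C \<in> I" "C \<subseteq> K" "lam K - lam C < \<epsilon> / 2"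
      using KI e2 by (rule approxE)
    obtain D where D: "D \<in> J" "D \<subseteq> K" "lam K - lam D < \<epsilon> / 2"
      using KJ e2 by (rule approxE)
    have comp: "compactin X C" "compactin X D"
      using I J C D by (auto simp: compact_ideal_def compacts_def)
    have "C \<inter> D \<in> I \<inter> J"
      using I J C D compact_Int[OF comp] by (auto simp: compact_ideal_def)
    moreover have "lam K - lam (C \<inter> D) < \<epsilon>"
      using defect_Int[OF Kc comp(2) comp(1)] C D by force
    ultimately show ?thesis using C by (intro bexI[of _ "C \<inter> D"]) auto
  qed
  then show "K \<in> approx (I \<inter> J)" using Kc by (simp add: approx_def)
next
  fix K assume "K \<in> approx (I \<inter> J)"
  then show "K \<in> approx I \<inter> approx J"
    using approx_mono[of "I \<inter> J" I] approx_mono[of "I \<inter> J" J] by blast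
qed

definition fin_unions :: "'a set set \<Rightarrow> 'a set set" where
  "fin_unions \<D> = {\<Union>\<F> | \<F>. finite \<F> \<and> \<F> \<subseteq> \<D>}"

lemma compact_ideal_fin_unions:
  assumes "\<D> \<subseteq> compacts" and down: "\<And>C D. \<lbrakk>D \<in> \<D>; compactin X C; C \<subseteq> D\<rbrakk> \<Longrightarrow> C \<in> \<D>"
  shows "compact_ideal (fin_unions \<D>)"
  unfolding compact_ideal_def
proof (intro conjI ballI allI impI)
  show "fin_unions \<D> \<subseteq> compacts"
    using assms by (auto simp: fin_unions_def compacts_def intro!: compact_Union)
  show "{} \<in> fin_unions \<D>" by (auto simp: fin_unions_def intro!: exI[of _ "{}"])
  fix K assume "K \<in> fin_unions \<D>"
  then obtain \<F> where F: "K = \<Union>\<F>" "finite \<F>" "\<F> \<subseteq> \<D>" by (auto simp: fin_unions_def)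
  show "C \<in> fin_unions \<D>" if C: "compactin X C \<and> C \<subseteq> K" for C
  proof -
    have "C \<inter> D \<in> \<D>" if D: "D \<in> \<F>" for D
    proof (rule down)
      show "D \<in> \<D>" using D F by blast
      then show "compactin X (C \<inter> D)" using C assms(1) by (auto simp: compacts_def intro: compact_Int)
    qed simp
    then have "(\<lambda>D. C \<inter> D) ` \<F> \<subseteq> \<D>" by blast
    moreover have "C = \<Union>((\<lambda>D. C \<inter> D) ` \<F>)" using F C by auto
    ultimately show ?thesis
      unfolding fin_unions_def using F by blast
  qed
  fix K' assume "K' \<in> fin_unions \<D>"
  then obtain \<F>' where F': "K' = \<Union>\<F>'" "finite \<F>'" "\<F>' \<subseteq> \<D>" by (auto simp: fin_unions_def)
  then have "K \<union> K' = \<Union>(\<F> \<union> \<F>')" "finite (\<F> \<union> \<F>')" "\<F> \<union> \<F>' \<subseteq> \<D>" using F by auto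
  then show "K \<union> K' \<in> fin_unions \<D>" unfolding fin_unions_def by blast
qed

lemma subset_fin_unions: "\<D> \<subseteq> fin_unions \<D>"
proof
  fix D assume "D \<in> \<D>"
  then have "D = \<Union>{D}" "finite {D}" "{D} \<subseteq> \<D>" by auto
  then show "D \<in> fin_unions \<D>" unfolding fin_unions_def by blast
qed

lemma fin_unions_least:
  assumes "compact_ideal I" "\<D> \<subseteq> I" shows "fin_unions \<D> \<subseteq> I"
  using assms compact_ideal_Union by (auto simp: fin_unions_def)

definition below :: "'a set \<Rightarrow> 'a set set" where
  "below V = {K. compactin X K \<and> K \<subseteq> V}"

lemma compact_ideal_below: "compact_ideal (below V)"
  by (auto simp: below_def compact_ideal_def compacts_def intro: compactin_Un)

text \<open>A compact subset of \<open>V \<union> W\<close> is the union of compact subsets of \<open>V\<close> and of \<open>W\<close>: the sets \<open>K - V\<close> and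
\<open>K - W\<close> are disjoint and compact, hence have disjoint neighbourhoods, whose complements in \<open>K\<close> are the
two pieces. The general case follows by induction on the number of open sets.\<close>

lemma split_compact:
  assumes ideal: "compact_ideal I" and "finite \<F>" "\<And>V. V \<in> \<F> \<Longrightarrow> openin X V"
    and "\<And>V C. \<lbrakk>V \<in> \<F>; compactin X C; C \<subseteq> V\<rbrakk> \<Longrightarrow> C \<in> I"
    and "compactin X K" "K \<subseteq> \<Union>\<F>"
  shows "K \<in> I"
  using assms(2-)
proof (induction \<F> arbitrary: K)
  case empty
  then show ?case using ideal by (auto simp: compact_ideal_def)
next
  case (insert V \<F>)
  have V: "openin X V" "openin X (\<Union>\<F>)" using insert.prems by auto
  have "compactin X (K - V)" "compactin X (K - \<Union>\<F>)" "disjnt (K - V) (K - \<Union>\<F>)"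
    using V insert.prems by (auto simp: disjnt_def intro: compact_diff)
  then obtain O1 O2 where O: "openin X O1" "openin X O2" "K - V \<subseteq> O1" "K - \<Union>\<F> \<subseteq> O2" "disjnt O1 O2"
    using Hausdorff_space_compact_separation[OF Hausdorff] by metis
  have "compactin X (K - O1)" "K - O1 \<subseteq> V"
    using insert.prems(3) O by (auto intro: compact_diff)
  then have "K - O1 \<in> I"
    using insert.prems(2)[of V] by blast
  moreover have "K - O2 \<in> I"
  proof (rule insert.IH)
    show "openin X W" if "W \<in> \<F>" for W using insert.prems(1) that by blast
    show "C \<in> I" if "W \<in> \<F>" "compactin X C" "C \<subseteq> W" for W C
      using insert.prems(2) that by blast
  qed (use insert.prems(3) O in \<open>auto intro: compact_diff\<close>)
  moreover have "K = (K - O1) \<union> (K - O2)" using O by (auto simp: disjnt_def)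
  ultimately show ?case using ideal unfolding compact_ideal_def by metis
qed

section \<open>Complements of content ideals\<close>

definition null_ideal :: "'a set set" where
  "null_ideal = {K. compactin X K \<and> lam K = 0}"

text \<open>The pseudocomplement of a \<open>\<lambda>\<close>-ideal.\<close>

definition disjoint_ideal :: "'a set set \<Rightarrow> 'a set set" where
  "disjoint_ideal U = {D. compactin X D \<and> (\<forall>E\<in>U. E \<subseteq> D \<longrightarrow> lam E = 0)}"

lemma approx_trivial: "approx {{}} = null_ideal"
proof -
  have "lam K = 0" if "compactin X K" "\<forall>\<epsilon>>0. lam K < \<epsilon>" for K
    using that nonneg[of K] by (metis less_irrefl order_le_less)
  then show ?thesis by (auto simp: approx_def null_ideal_def lam_empty)
qed

lemma compact_ideal_trivial: "compact_ideal {{}}"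
  by (auto simp: compact_ideal_def compacts_def)

text \<open>A member \<open>E\<close> of \<open>U\<close> inside \<open>K\<close> meets every approximant of \<open>K\<close> in a set of content zero, so the content of
\<open>E\<close> is at most the defect of the approximation.\<close>

lemma content_ideal_disjoint:
  assumes U: "content_ideal X lam U"
  shows "content_ideal X lam (disjoint_ideal U)"
  unfolding content_ideal_def
proof (intro conjI allI impI)
  note ideal = content_ideal_imp_compact_ideal[OF U]
  show "disjoint_ideal U \<subseteq> {K. compactin X K}" by (auto simp: disjoint_ideal_def)
  show "\<forall>K\<in>disjoint_ideal U. \<forall>C. compactin X C \<and> C \<subseteq> K \<longrightarrow> C \<in> disjoint_ideal U"
    by (auto simp: disjoint_ideal_def)
  fix K \<A>
  assume A: "compactin X K \<and> \<A> \<subseteq> disjoint_ideal U \<and> (\<forall>C\<in>\<A>. C \<subseteq> K) \<and>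
      (\<forall>\<epsilon>>0. \<exists>\<F>. finite \<F> \<and> \<F> \<subseteq> \<A> \<and> lam K - lam (\<Union>\<F>) < \<epsilon>)"
  have "lam E = 0" if E: "E \<in> U" "E \<subseteq> K" for E
  proof -
    have Ec: "compactin X E" using ideal E by (auto simp: compact_ideal_def compacts_def)
    have "lam E \<le> 0 + \<epsilon>" if e: "0 < \<epsilon>" for \<epsilon>
    proof -
      obtain \<F> where F: "finite \<F>" "\<F> \<subseteq> \<A>" "lam K - lam (\<Union>\<F>) < \<epsilon>"
        using A e by blast
      have D: "compactin X D" "lam (E \<inter> D) = 0" if "D \<in> \<F>" for D
      proof -
        have "D \<in> disjoint_ideal U" using that F A by auto
        then show D: "compactin X D" by (simp add: disjoint_ideal_def)
        have "compactin X (E \<inter> D)" using D Ec by (rule compact_Int[rotated])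
        then have "E \<inter> D \<in> U" using ideal E by (auto simp: compact_ideal_def)
        then show "lam (E \<inter> D) = 0"
          using \<open>D \<in> disjoint_ideal U\<close> unfolding disjoint_ideal_def by blast
      qed
      have "lam (\<Union>((\<lambda>D. E \<inter> D) ` \<F>)) = 0"
        using F D Ec by (intro lam_null_UN) (auto intro: compact_Int)
      moreover have "\<Union>((\<lambda>D. E \<inter> D) ` \<F>) = E \<inter> \<Union>\<F>" by auto
      moreover have "lam E - lam (E \<inter> \<Union>\<F>) \<le> lam K - lam (\<Union>\<F>)"
      proof (rule defect_Int)
        show "compactin X K" "\<Union>\<F> \<subseteq> K" using A F(2) by blast+
        show "compactin X (\<Union>\<F>)" using F(1) D(1) by (rule compact_Union)
      qed (use E Ec in auto)
      ultimately show ?thesis using F by simp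
    qed
    then have "lam E \<le> 0" by (rule field_le_epsilon)
    then show ?thesis using nonneg[OF Ec] by simp
  qed
  then show "K \<in> disjoint_ideal U" using A by (auto simp: disjoint_ideal_def)
qed

text \<open>Let \<open>m\<close> be the supremum of the contents of the members of \<open>U\<close> inside \<open>K\<close>. Choose \<open>C n\<close> in \<open>U\<close> of content
nearly \<open>m\<close> and remove from \<open>K\<close> small neighbourhoods \<open>V n\<close> of all of them. The rest \<open>D\<close> has
content at least \<open>\<lambda>(K) - m - \<epsilon> / 2\<close>, because the union of finitely many \<open>C n\<close> still has content at most \<open>m\<close>. A
member of \<open>U\<close> inside \<open>D\<close> is disjoint from every \<open>C n\<close>, so that by maximality of \<open>m\<close> its content is below every
positive bound.\<close>

lemma disjoint_ideal_approx_covers: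
  assumes U: "content_ideal X lam U" and K: "compactin X K" and e: "0 < \<epsilon>"
  obtains C D where "C \<in> U" "D \<in> disjoint_ideal U" "C \<subseteq> K" "D \<subseteq> K" "lam K - lam (C \<union> D) < \<epsilon>"
proof -
  note ideal = content_ideal_imp_compact_ideal[OF U]
  have comp: "compactin X C" if "C \<in> U" for C
    using ideal that by (auto simp: compact_ideal_def compacts_def)
  let ?S = "lam ` {C \<in> U. C \<subseteq> K}"
  define m where "m = Sup ?S"
  have "{} \<in> U" using ideal by (simp add: compact_ideal_def)
  then have ne: "?S \<noteq> {}" by blast
  have bdd: "bdd_above ?S"
    using comp K by (intro bdd_aboveI[of _ "lam K"]) (auto intro: mono)
  have le_m: "lam C \<le> m" if "C \<in> U" "C \<subseteq> K" for C
    unfolding m_def using bdd that by (intro cSup_upper) auto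
  \<comment> \<open>The \<open>\<delta> n\<close> add up to \<open>\<epsilon> / 2\<close>, and \<open>\<delta> 0 = \<epsilon> / 4\<close>; both errors together stay below \<open>\<epsilon>\<close>.\<close>
  define \<delta> where "\<delta> n = \<epsilon> / 4 * (1/2) ^ n" for n :: nat
  have \<delta>: "0 < \<delta> n" for n using e by (simp add: \<delta>_def)
  have "\<exists>C. C \<in> U \<and> C \<subseteq> K \<and> m - \<delta> n < lam C" for n
    using less_cSup_iff[OF ne bdd, of "m - \<delta> n"] \<delta>[of n] by (auto simp: m_def)
  then obtain C where C: "\<And>n. C n \<in> U" "\<And>n. C n \<subseteq> K" "\<And>n. m - \<delta> n < lam (C n)"
    by metis
  have "\<exists>V K'. openin X V \<and> compactin X K' \<and> C n \<subseteq> V \<and> V \<subseteq> K' \<and> lam K' < lam (C n) + \<delta> n" for n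
    using nbhd_approx[OF comp[OF C(1)] \<delta>] by metis
  then obtain V K' where V: "\<And>n. openin X (V n)" "\<And>n. compactin X (K' n)" "\<And>n. C n \<subseteq> V n"
      "\<And>n. V n \<subseteq> K' n" "\<And>n. lam (K' n) < lam (C n) + \<delta> n"
    by metis
  define D where "D = K - (\<Union>n. V n)"
  have D: "compactin X D" unfolding D_def using K V(1) by (intro compact_diff) auto
  have "lam E = 0" if E: "E \<in> U" "E \<subseteq> D" for E
  proof -
    have "lam E \<le> \<delta> n" for n
    proof -
      have "E \<inter> C n = {}" using E V(3)[of n] by (auto simp: D_def)
      then have "lam E + lam (C n) = lam (E \<union> C n)"
        using comp E C(1) by (intro additive[symmetric]) auto
      also have "\<dots> \<le> m"
        using E C ideal by (intro le_m) (auto simp: compact_ideal_def D_def)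
      finally show ?thesis using C(3)[of n] by linarith
    qed
    moreover have "\<delta> \<longlonglongrightarrow> \<epsilon> / 4 * 0"
      unfolding \<delta>_def by (intro tendsto_intros LIMSEQ_realpow_zero) auto
    ultimately have "lam E \<le> 0"
      using LIMSEQ_le_const[of \<delta> "\<epsilon> / 4 * 0" "lam E"] by auto
    then show ?thesis using nonneg[OF comp[OF E(1)]] by simp
  qed
  then have "D \<in> disjoint_ideal U" using D by (auto simp: disjoint_ideal_def)
  \<comment> \<open>Compare \<open>D\<close> with a neighbourhood \<open>W\<close>: compactness of \<open>K\<close> leaves only finitely many of the \<open>V n\<close>.\<close>
  moreover have "lam K - m - \<epsilon> / 2 \<le> lam D"
  proof (rule field_le_epsilon)
    fix \<eta> :: real assume "0 < \<eta>"
    then obtain W L where W: "openin X W" "compactin X L" "D \<subseteq> W" "W \<subseteq> L" "lam L < lam D + \<eta>"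
      using nbhd_approx[OF D] by metis
    have opens: "openin X Z" if "Z \<in> insert W (range V)" for Z
      using that W(1) V(1) by blast
    have cover: "K \<subseteq> \<Union>(insert W (range V))" using W by (auto simp: D_def)
    obtain \<F> where F: "finite \<F>" "\<F> \<subseteq> insert W (range V)" "K \<subseteq> \<Union>\<F>"
      using compactinD[OF K opens cover] by blast
    have "\<F> - {W} \<subseteq> range V" using F(2) by blast
    then obtain J where J: "finite J" "\<F> - {W} = V ` J"
      using finite_subset_image[OF finite_Diff[OF F(1)]] by metis
    have "K \<subseteq> L \<union> (\<Union>n\<in>J. K' n)"
    proof
      fix x assume "x \<in> K"
      then obtain Z where Z: "Z \<in> \<F>" "x \<in> Z" using F by blast
      show "x \<in> L \<union> (\<Union>n\<in>J. K' n)"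
      proof (cases "Z = W")
        case False
        then obtain n where "n \<in> J" "Z = V n" using Z J by blast
        then show ?thesis using Z(2) V(4)[of n] by blast
      qed (use Z(2) W(4) in blast)
    qed
    moreover have comp_K': "compactin X (\<Union>n\<in>J. K' n)" using J(1) V(2) by (intro compact_Union) auto
    ultimately have "lam K \<le> lam (L \<union> (\<Union>n\<in>J. K' n))"
      using K W(2) by (intro mono compactin_Un) auto
    also have "\<dots> \<le> lam L + lam (\<Union>n\<in>J. K' n)"
      using W(2) comp_K' by (rule subadditive)
    finally have 1: "lam K \<le> lam L + lam (\<Union>n\<in>J. K' n)" .
    have "lam (\<Union>n\<in>J. K' n) - lam (\<Union>n\<in>J. C n) \<le> (\<Sum>n\<in>J. lam (K' n) - lam (C n))"
      using V(3,4) comp[OF C(1)] V(2) by (intro defect_UN J(1) conjI) (blast intro: order_trans)+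
    also have "\<dots> \<le> (\<Sum>n\<in>J. \<delta> n)"
      using less_imp_le[OF V(5)] by (intro sum_mono) (simp add: algebra_simps)
    also have "\<dots> \<le> (\<Sum>n. \<delta> n)"
      using J(1) \<delta> by (intro sum_le_suminf) (auto simp: \<delta>_def less_imp_le intro!: summable_mult)
    also have "\<dots> = \<epsilon> / 2"
      unfolding \<delta>_def using e by (subst suminf_mult) (auto simp: suminf_geometric)
    finally have 2: "lam (\<Union>n\<in>J. K' n) \<le> lam (\<Union>n\<in>J. C n) + \<epsilon> / 2" by simp
    have "lam (\<Union>n\<in>J. C n) \<le> m"
    proof (rule le_m)
      show "(\<Union>n\<in>J. C n) \<in> U"
        using J(1) C(1) by (intro compact_ideal_Union[OF ideal]) auto
    qed (use C(2) in auto)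
    with 1 2 W show "lam K - m - \<epsilon> / 2 \<le> lam D + \<eta>" by linarith
  qed
  moreover have "lam (C 0 \<union> D) = lam (C 0) + lam D"
    using comp C(1) D V(3)[of 0] by (intro additive) (auto simp: D_def)
  moreover have "m - \<epsilon> / 4 < lam (C 0)" using C(3)[of 0] by (simp add: \<delta>_def)
  ultimately show ?thesis
    using e C by (intro that[of "C 0" D]) (auto simp: D_def)
qed

end

section \<open>The locales of open sets and of content ideals\<close>

lemma opens_frame_simps [simp]:
  "carrier (opens_frame X) = {U. openin X U}"
  "U \<sqsubseteq>\<^bsub>opens_frame X\<^esub> V \<longleftrightarrow> U \<subseteq> V"
  by (simp_all add: opens_frame_def)

lemma partial_order_opens: "partial_order (opens_frame X)"
  by unfold_locales (auto simp: opens_frame_def)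

lemma sup_opens:
  assumes "\<V> \<subseteq> {U. openin X U}"
  shows "\<Squnion>\<^bsub>opens_frame X\<^esub>\<V> = \<Union>\<V>"
proof -
  interpret partial_order "opens_frame X" by (rule partial_order_opens)
  show ?thesis using assms by (intro sup_eqI) auto
qed

lemma meet_opens:
  assumes "openin X U" "openin X V"
  shows "U \<sqinter>\<^bsub>opens_frame X\<^esub> V = U \<inter> V"
proof -
  interpret partial_order "opens_frame X" by (rule partial_order_opens)
  show ?thesis using assms by (intro meet_eqI) auto
qed

lemma top_opens: "\<top>\<^bsub>opens_frame X\<^esub> = topspace X"
proof -
  interpret partial_order "opens_frame X" by (rule partial_order_opens)
  show ?thesis by (rule top_eqI) (auto dest: openin_subset)
qed

lemma frame_opens: "frame (opens_frame X)"
proof -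
  interpret partial_order "opens_frame X" by (rule partial_order_opens)
  interpret complete_lattice "opens_frame X"
  proof (rule complete_latticeI)
    fix \<V> assume V: "\<V> \<subseteq> carrier (opens_frame X)"
    then have "least (opens_frame X) (\<Union>\<V>) (Upper (opens_frame X) \<V>)"
      by (intro least_UpperI) (auto simp: Upper_def)
    then show "\<exists>s. least (opens_frame X) s (Upper (opens_frame X) \<V>)" ..
    have "greatest (opens_frame X) (X interior_of (topspace X \<inter> \<Inter>\<V>)) (Lower (opens_frame X) \<V>)"
    proof (rule greatest_LowerI)
      show "X interior_of (topspace X \<inter> \<Inter>\<V>) \<sqsubseteq>\<^bsub>opens_frame X\<^esub> V" if "V \<in> \<V>" for V
        using that interior_of_subset[of X "topspace X \<inter> \<Inter>\<V>"] by auto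
      show "W \<sqsubseteq>\<^bsub>opens_frame X\<^esub> X interior_of (topspace X \<inter> \<Inter>\<V>)"
        if "W \<in> Lower (opens_frame X) \<V>" for W
      proof -
        have W: "openin X W" "W \<subseteq> V" if "V \<in> \<V>" for V
          using \<open>W \<in> _\<close> V that by (auto simp: Lower_def)
        have "openin X W" using \<open>W \<in> _\<close> by (simp add: Lower_def)
        then have "W \<subseteq> X interior_of (topspace X \<inter> \<Inter>\<V>)"
          using W(2) by (intro interior_of_maximal) (auto dest: openin_subset)
        then show ?thesis by simp
      qed
    qed (use V in auto)
    then show "\<exists>i. greatest (opens_frame X) i (Lower (opens_frame X) \<V>)" ..
  qed
  show ?thesis
  proof (rule frameI)
    fix V \<U> assume "V \<in> carrier (opens_frame X)" "\<U> \<subseteq> carrier (opens_frame X)"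
    then have V: "openin X V" and U: "\<U> \<subseteq> {U. openin X U}" by auto
    then have "openin X (\<Union>\<U>)" by auto
    then have "V \<sqinter>\<^bsub>opens_frame X\<^esub> \<Squnion>\<^bsub>opens_frame X\<^esub>\<U> = V \<inter> \<Union>\<U>"
      using V U by (simp add: sup_opens meet_opens)
    moreover have "(\<lambda>U. V \<sqinter>\<^bsub>opens_frame X\<^esub> U) ` \<U> = (\<lambda>U. V \<inter> U) ` \<U>"
      using V U by (intro image_cong) (auto simp: meet_opens)
    moreover have "\<Squnion>\<^bsub>opens_frame X\<^esub>((\<lambda>U. V \<inter> U) ` \<U>) = \<Union>((\<lambda>U. V \<inter> U) ` \<U>)"
      using V U by (intro sup_opens) auto
    ultimately show "V \<sqinter>\<^bsub>opens_frame X\<^esub> \<Squnion>\<^bsub>opens_frame X\<^esub>\<U>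
        \<sqsubseteq>\<^bsub>opens_frame X\<^esub> \<Squnion>\<^bsub>opens_frame X\<^esub>((\<lambda>U. V \<sqinter>\<^bsub>opens_frame X\<^esub> U) ` \<U>)"
      by simp
  qed
qed

context hausdorff_content
begin

abbreviation "CL \<equiv> content_locale X lam"

lemma content_locale_simps [simp]:
  "carrier CL = {U. content_ideal X lam U}"
  "U \<sqsubseteq>\<^bsub>CL\<^esub> V \<longleftrightarrow> U \<subseteq> V"
  by (simp_all add: content_locale_def)

lemma content_ideal_subset: "content_ideal X lam U \<Longrightarrow> U \<subseteq> compacts"
  using content_ideal_imp_compact_ideal by (simp add: compact_ideal_def)

lemma content_ideal_down: "\<lbrakk>content_ideal X lam U; K \<in> U; compactin X C; C \<subseteq> K\<rbrakk> \<Longrightarrow> C \<in> U"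
  using content_ideal_imp_compact_ideal by (auto simp: compact_ideal_def)

lemma content_ideal_Inter:
  assumes "\<And>U. U \<in> \<U> \<Longrightarrow> content_ideal X lam U"
  shows "content_ideal X lam (compacts \<inter> \<Inter>\<U>)"
  unfolding content_ideal_def
proof (intro conjI allI impI)
  show "compacts \<inter> \<Inter>\<U> \<subseteq> {K. compactin X K}" by (auto simp: compacts_def)
  show "\<forall>K\<in>compacts \<inter> \<Inter>\<U>. \<forall>C. compactin X C \<and> C \<subseteq> K \<longrightarrow> C \<in> compacts \<inter> \<Inter>\<U>"
    using content_ideal_down[OF assms] by (auto simp: compacts_def)
  fix K \<A>
  assume A: "compactin X K \<and> \<A> \<subseteq> compacts \<inter> \<Inter>\<U> \<and> (\<forall>C\<in>\<A>. C \<subseteq> K) \<and>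
      (\<forall>\<epsilon>>0. \<exists>\<F>. finite \<F> \<and> \<F> \<subseteq> \<A> \<and> lam K - lam (\<Union>\<F>) < \<epsilon>)"
  have "K \<in> U" if U: "U \<in> \<U>" for U
  proof -
    have "\<A> \<subseteq> U" using A U by blast
    then show ?thesis using assms[OF U] A unfolding content_ideal_def by metis
  qed
  then show "K \<in> compacts \<inter> \<Inter>\<U>" using A by (auto simp: compacts_def)
qed

lemma content_ideal_compacts: "content_ideal X lam compacts"
  using content_ideal_Inter[of "{}"] by simp

lemma complete_lattice_content: "complete_lattice CL"
  unfolding content_locale_def
proof (rule complete_lattice_moore_family[where T = compacts])
  show "compacts \<inter> \<Inter>\<A> \<in> {U. content_ideal X lam U}" if "\<A> \<subseteq> {U. content_ideal X lam U}" for \<A>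
    using that by (auto intro!: content_ideal_Inter)
qed (auto simp: content_ideal_compacts dest: content_ideal_subset)

sublocale C: complete_lattice CL
  by (rule complete_lattice_content)

lemma compact_ideal_fin_unions_content:
  assumes "\<And>U. U \<in> \<U> \<Longrightarrow> content_ideal X lam U"
  shows "compact_ideal (fin_unions (\<Union>\<U>))"
proof (rule compact_ideal_fin_unions)
  show "\<Union>\<U> \<subseteq> compacts" using assms content_ideal_subset by blast
  show "C \<in> \<Union>\<U>" if "D \<in> \<Union>\<U>" "compactin X C" "C \<subseteq> D" for C D
    using assms content_ideal_down that by blast
qed

lemma sup_content:
  assumes U: "\<And>U. U \<in> \<U> \<Longrightarrow> content_ideal X lam U"
  shows "\<Squnion>\<^bsub>CL\<^esub>\<U> = approx (fin_unions (\<Union>\<U>))"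
proof (rule C.sup_eqI)
  note ideal = compact_ideal_fin_unions_content[OF U]
  show "approx (fin_unions (\<Union>\<U>)) \<in> carrier CL" by (simp add: content_ideal_approx ideal)
  show "V \<sqsubseteq>\<^bsub>CL\<^esub> approx (fin_unions (\<Union>\<U>))" if "V \<in> \<U>" for V
    using that subset_approx[OF ideal] subset_fin_unions[of "\<Union>\<U>"] by auto
  show "approx (fin_unions (\<Union>\<U>)) \<sqsubseteq>\<^bsub>CL\<^esub> Y"
    if "Y \<in> carrier CL" "\<And>V. V \<in> \<U> \<Longrightarrow> V \<sqsubseteq>\<^bsub>CL\<^esub> Y" for Y
  proof -
    have Y: "content_ideal X lam Y" "\<Union>\<U> \<subseteq> Y" using that by auto
    then have "fin_unions (\<Union>\<U>) \<subseteq> Y" by (intro fin_unions_least content_ideal_imp_compact_ideal)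
    then show ?thesis using Y by (simp add: approx_least)
  qed
qed (use U in auto)

lemma content_ideal_Int:
  assumes "content_ideal X lam U" "content_ideal X lam V"
  shows "content_ideal X lam (U \<inter> V)"
proof -
  have "compacts \<inter> \<Inter>{U, V} = U \<inter> V" using assms content_ideal_subset by auto
  then show ?thesis using content_ideal_Inter[of "{U, V}"] assms by auto
qed

lemma meet_content:
  assumes "content_ideal X lam U" "content_ideal X lam V"
  shows "U \<sqinter>\<^bsub>CL\<^esub> V = U \<inter> V"
  using assms content_ideal_Int by (intro C.meet_eqI) auto

lemma top_content: "\<top>\<^bsub>CL\<^esub> = compacts"
  by (rule C.top_eqI) (auto simp: content_ideal_compacts dest: content_ideal_subset)

lemma bottom_content: "\<bottom>\<^bsub>CL\<^esub> = null_ideal"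
proof (rule C.bottom_eqI)
  show "null_ideal \<in> carrier CL"
    using content_ideal_approx[OF compact_ideal_trivial] by (simp add: approx_trivial)
  show "null_ideal \<sqsubseteq>\<^bsub>CL\<^esub> Y" if "Y \<in> carrier CL" for Y
  proof -
    have Y: "content_ideal X lam Y" using that by simp
    have "{} \<in> Y" using content_ideal_imp_compact_ideal[OF Y] unfolding compact_ideal_def by blast
    then have "approx {{}} \<subseteq> Y" using Y by (intro approx_least) auto
    then show ?thesis by (simp add: approx_trivial)
  qed
qed

text \<open>If \<open>K \<in> V\<close> is approximated by finite unions of members of the \<open>U \<in> \<U>\<close>, then these members are subsets of \<open>K\<close>
and so belong to \<open>V\<close> as well.\<close>

lemma frame_content: "frame CL"
proof (rule C.frameI)
  fix V \<U> assume "V \<in> carrier CL" "\<U> \<subseteq> carrier CL"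
  then have V: "content_ideal X lam V" and U: "\<And>U. U \<in> \<U> \<Longrightarrow> content_ideal X lam U" by auto
  let ?W = "(\<lambda>U. V \<inter> U) ` \<U>"
  have W: "content_ideal X lam Y" if "Y \<in> ?W" for Y
    using that V U by (auto intro: content_ideal_Int)
  have "V \<inter> approx (fin_unions (\<Union>\<U>)) \<subseteq> approx (fin_unions (\<Union>?W))"
  proof
    fix K assume K: "K \<in> V \<inter> approx (fin_unions (\<Union>\<U>))"
    then have KV: "K \<in> V" and Kc: "compactin X K" by (auto simp: approx_def)
    have "\<exists>C\<in>fin_unions (\<Union>?W). C \<subseteq> K \<and> lam K - lam C < \<epsilon>" if e: "0 < \<epsilon>" for \<epsilon>
    proof -
      have "K \<in> approx (fin_unions (\<Union>\<U>))" using K by simp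
      then obtain C where C: "C \<in> fin_unions (\<Union>\<U>)" "C \<subseteq> K" "lam K - lam C < \<epsilon>"
        using e by (rule approxE)
      then obtain \<F> where F: "finite \<F>" "\<F> \<subseteq> \<Union>\<U>" "C = \<Union>\<F>" by (auto simp: fin_unions_def)
      have "D \<in> \<Union>?W" if D: "D \<in> \<F>" for D
      proof -
        obtain U' where U': "U' \<in> \<U>" "D \<in> U'" using F D by blast
        then have "compactin X D" using content_ideal_subset[OF U] by (auto simp: compacts_def)
        moreover have "D \<subseteq> K" using D F C by blast
        ultimately have "D \<in> V" using content_ideal_down[OF V KV] by blast
        then show ?thesis using U' by blast
      qed
      then have "C \<in> fin_unions (\<Union>?W)" using F unfolding fin_unions_def by blast
      then show ?thesis using C by blast
    qed
    then show "K \<in> approx (fin_unions (\<Union>?W))" using Kc by (simp add: approx_def)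
  qed
  moreover have "(\<lambda>U. V \<sqinter>\<^bsub>CL\<^esub> U) ` \<U> = ?W"
    using V U by (intro image_cong) (auto simp: meet_content)
  moreover have "\<Squnion>\<^bsub>CL\<^esub>\<U> = approx (fin_unions (\<Union>\<U>))" using U by (rule sup_content)
  moreover have "\<Squnion>\<^bsub>CL\<^esub>?W = approx (fin_unions (\<Union>?W))" using W by (rule sup_content)
  moreover have "content_ideal X lam (approx (fin_unions (\<Union>\<U>)))"
    using U by (intro content_ideal_approx compact_ideal_fin_unions_content)
  ultimately show "V \<sqinter>\<^bsub>CL\<^esub> \<Squnion>\<^bsub>CL\<^esub>\<U> \<sqsubseteq>\<^bsub>CL\<^esub> \<Squnion>\<^bsub>CL\<^esub>((\<lambda>U. V \<sqinter>\<^bsub>CL\<^esub> U) ` \<U>)"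
    using V by (simp add: meet_content)
qed

lemma join_content_eq_top:
  assumes U: "content_ideal X lam U" and V: "content_ideal X lam V"
    and cover: "\<And>K \<epsilon>. \<lbrakk>compactin X K; 0 < \<epsilon>\<rbrakk> \<Longrightarrow>
      \<exists>C\<in>U. \<exists>D\<in>V. C \<subseteq> K \<and> D \<subseteq> K \<and> lam K - lam (C \<union> D) < \<epsilon>"
  shows "U \<squnion>\<^bsub>CL\<^esub> V = \<top>\<^bsub>CL\<^esub>"
proof -
  have join: "U \<squnion>\<^bsub>CL\<^esub> V = approx (fin_unions (\<Union>{U, V}))"
    unfolding join_def using U V by (intro sup_content) auto
  have "K \<in> approx (fin_unions (\<Union>{U, V}))" if K: "compactin X K" for K
  proof -
    have "\<exists>C\<in>fin_unions (\<Union>{U, V}). C \<subseteq> K \<and> lam K - lam C < \<epsilon>" if e: "0 < \<epsilon>" for \<epsilon>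
    proof -
      obtain C D where CD: "C \<in> U" "D \<in> V" "C \<subseteq> K" "D \<subseteq> K" "lam K - lam (C \<union> D) < \<epsilon>"
        using cover[OF K e] by blast
      have "C \<union> D = \<Union>{C, D}" "finite {C, D}" "{C, D} \<subseteq> \<Union>{U, V}" using CD by auto
      then have "C \<union> D \<in> fin_unions (\<Union>{U, V})" unfolding fin_unions_def by blast
      then show ?thesis using CD by blast
    qed
    then show ?thesis using K by (simp add: approx_def)
  qed
  moreover have "approx (fin_unions (\<Union>{U, V})) \<subseteq> compacts"
    by (auto simp: approx_def compacts_def)
  ultimately show ?thesis
    unfolding join top_content by (auto simp: compacts_def)
qed

lemma boolean_frame_content: "boolean_frame CL"
proof -
  interpret frame CL by (rule frame_content)
  show ?thesis
  proof
    fix U assume "U \<in> carrier CL"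
    then have U: "content_ideal X lam U" by simp
    note D = content_ideal_disjoint[OF U]
    have "U \<inter> disjoint_ideal U \<subseteq> null_ideal"
      by (auto simp: disjoint_ideal_def null_ideal_def)
    moreover have "null_ideal \<subseteq> U \<inter> disjoint_ideal U"
      using C.weak.bottom_lower[of "U \<inter> disjoint_ideal U"] content_ideal_Int[OF U D]
      by (simp add: bottom_content)
    ultimately have "U \<sqinter>\<^bsub>CL\<^esub> disjoint_ideal U = \<bottom>\<^bsub>CL\<^esub>"
      using U D by (simp add: meet_content bottom_content)
    moreover have "U \<squnion>\<^bsub>CL\<^esub> disjoint_ideal U = \<top>\<^bsub>CL\<^esub>"
    proof (rule join_content_eq_top[OF U D])
      fix K and \<epsilon> :: real assume "compactin X K" "0 < \<epsilon>"
      from disjoint_ideal_approx_covers[OF U this]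
      show "\<exists>C\<in>U. \<exists>D\<in>disjoint_ideal U. C \<subseteq> K \<and> D \<subseteq> K \<and> lam K - lam (C \<union> D) < \<epsilon>"
        by metis
    qed
    ultimately show "\<exists>V\<in>carrier CL. U \<sqinter>\<^bsub>CL\<^esub> V = \<bottom>\<^bsub>CL\<^esub> \<and> U \<squnion>\<^bsub>CL\<^esub> V = \<top>\<^bsub>CL\<^esub>"
      using D by auto
  qed
qed

lemma content_ideal_approx_below: "content_ideal X lam (approx (below V))"
  by (intro content_ideal_approx compact_ideal_below)

lemma content_proj_eq: "openin X V \<Longrightarrow> content_proj X lam V = approx (below V)"
  using hull_eq_approx[OF compact_ideal_below] by (simp add: content_proj_def below_def)

text \<open>Binary meets are preserved because generated \<open>\<lambda>\<close>-ideals commute with intersections. Joins are preserved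
because a compact set covered by open sets is a finite union of compact sets, each inside one of them.\<close>

lemma frame_hom_content_proj: "frame_hom (opens_frame X) CL (content_proj X lam)"
proof -
  interpret O: frame "opens_frame X" by (rule frame_opens)
  interpret M: frame CL by (rule frame_content)
  show ?thesis
  proof
    show "content_proj X lam \<in> carrier (opens_frame X) \<rightarrow> carrier CL"
      by (auto simp: content_proj_eq content_ideal_approx_below)
    have "below (topspace X) = compacts"
      by (auto simp: below_def compacts_def dest: compactin_subset_topspace)
    moreover have "approx compacts = compacts"
      using subset_approx[OF content_ideal_imp_compact_ideal[OF content_ideal_compacts]]
      by (auto simp: approx_def compacts_def)
    ultimately show "content_proj X lam \<top>\<^bsub>opens_frame X\<^esub> = \<top>\<^bsub>CL\<^esub>"
      by (simp add: top_opens content_proj_eq top_content)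
    show "content_proj X lam (V \<sqinter>\<^bsub>opens_frame X\<^esub> W) = content_proj X lam V \<sqinter>\<^bsub>CL\<^esub> content_proj X lam W"
      if "V \<in> carrier (opens_frame X)" "W \<in> carrier (opens_frame X)" for V W
    proof -
      have "below (V \<inter> W) = below V \<inter> below W" by (auto simp: below_def)
      then show ?thesis
        using that
        by (simp add: meet_opens openin_Int content_proj_eq meet_content content_ideal_approx_below approx_Int compact_ideal_below)
    qed
    show "content_proj X lam (\<Squnion>\<^bsub>opens_frame X\<^esub>\<V>) = \<Squnion>\<^bsub>CL\<^esub>(content_proj X lam ` \<V>)"
      if "\<V> \<subseteq> carrier (opens_frame X)" for \<V>
    proof -
      have V: "openin X V" if "V \<in> \<V>" for V using that \<open>\<V> \<subseteq> carrier (opens_frame X)\<close> by auto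
      have "\<Squnion>\<^bsub>CL\<^esub>((\<lambda>V. approx (below V)) ` \<V>) = approx (below (\<Union>\<V>))"
      proof (rule C.sup_eqI)
        fix Y assume Y: "Y \<in> carrier CL" "\<And>U. U \<in> (\<lambda>V. approx (below V)) ` \<V> \<Longrightarrow> U \<sqsubseteq>\<^bsub>CL\<^esub> Y"
        then have Yi: "content_ideal X lam Y" by simp
        have sub: "below V \<subseteq> Y" if "V \<in> \<V>" for V
          using Y(2)[of "approx (below V)"] subset_approx[OF compact_ideal_below[of V]] that by auto
        have "K \<in> Y" if K: "K \<in> below (\<Union>\<V>)" for K
        proof -
          have Kc: "compactin X K" "K \<subseteq> \<Union>\<V>" using K by (auto simp: below_def)
          then obtain \<F> where F: "finite \<F>" "\<F> \<subseteq> \<V>" "K \<subseteq> \<Union>\<F>"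
            using compactinD[OF Kc(1) V Kc(2)] by blast
          show ?thesis
          proof (rule split_compact[OF content_ideal_imp_compact_ideal[OF Yi] F(1)])
            show "openin X V" if "V \<in> \<F>" for V using V F that by blast
            show "C \<in> Y" if "V \<in> \<F>" "compactin X C" "C \<subseteq> V" for V C
              using sub[of V] F that by (auto simp: below_def)
          qed (use Kc F in auto)
        qed
        then show "approx (below (\<Union>\<V>)) \<sqsubseteq>\<^bsub>CL\<^esub> Y" using approx_least[OF Yi, of "below (\<Union>\<V>)"] by auto
      next
        fix U assume "U \<in> (\<lambda>V. approx (below V)) ` \<V>"
        then obtain V where "V \<in> \<V>" "U = approx (below V)" by blast
        moreover from this have "below V \<subseteq> below (\<Union>\<V>)" by (auto simp: below_def)
        ultimately show "U \<sqsubseteq>\<^bsub>CL\<^esub> approx (below (\<Union>\<V>))" by (simp add: approx_mono)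
      qed (auto simp: content_ideal_approx_below)
      moreover have "content_proj X lam ` \<V> = (\<lambda>V. approx (below V)) ` \<V>"
        using V by (intro image_cong) (auto simp: content_proj_eq)
      moreover have "openin X (\<Union>\<V>)" using V by auto
      moreover have "\<Squnion>\<^bsub>opens_frame X\<^esub>\<V> = \<Union>\<V>" using V by (intro sup_opens) auto
      ultimately show ?thesis by (simp add: content_proj_eq)
    qed
  qed
qed

section \<open>The embedding\<close>

sublocale B: boolean_valued_hom "opens_frame X" CL "content_proj X lam"
  by (intro boolean_valued_hom.intro frame_hom_content_proj boolean_frame_content)

text \<open>Only the empty set lies both in \<open>K\<close> and in its complement, so the two \<open>\<lambda>\<close>-ideals meet in the bottom
element. To approximate \<open>C\<close> by members of both, take \<open>C \<inter> K\<close> together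
with \<open>C - V\<close>, where \<open>V\<close> is a neighbourhood of \<open>C \<inter> K\<close> inside a compact set of nearly the same content.\<close>

lemma compact_complement:
  assumes K: "compactin X K"
  shows "B.neg (content_proj X lam (topspace X - K)) = approx (below K)"
proof (rule B.complement_eq_neg[symmetric])
  have op: "openin X (topspace X - K)" using compact_closed[OF K] by auto
  then show "content_proj X lam (topspace X - K) \<in> carrier CL"
    by (simp add: content_proj_eq content_ideal_approx_below)
  show "approx (below K) \<in> carrier CL" by (simp add: content_ideal_approx_below)
  have "below (topspace X - K) \<inter> below K = {{}}" by (auto simp: below_def)
  then show "content_proj X lam (topspace X - K) \<sqinter>\<^bsub>CL\<^esub> approx (below K) = \<bottom>\<^bsub>CL\<^esub>"
    using op approx_Int[OF compact_ideal_below compact_ideal_below, of "topspace X - K" K]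
    by (simp add: content_proj_eq meet_content content_ideal_approx_below bottom_content approx_trivial)
  have "approx (below (topspace X - K)) \<squnion>\<^bsub>CL\<^esub> approx (below K) = \<top>\<^bsub>CL\<^esub>"
  proof (rule join_content_eq_top)
    fix C and \<epsilon> :: real assume C: "compactin X C" and e: "0 < \<epsilon>"
    have CK: "compactin X (C \<inter> K)" using C K by (rule compact_Int)
    obtain V L where V: "openin X V" "compactin X L" "C \<inter> K \<subseteq> V" "V \<subseteq> L" "lam L < lam (C \<inter> K) + \<epsilon>"
      using nbhd_approx[OF CK e] .
    have CV: "compactin X (C - V)" using C V(1) by (rule compact_diff)
    have "lam C \<le> lam ((C - V) \<union> L)" using C CV V by (intro mono compactin_Un) auto
    also have "\<dots> \<le> lam (C - V) + lam L" using CV V(2) by (rule subadditive)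
    also have "\<dots> < lam (C - V) + lam (C \<inter> K) + \<epsilon>" using V(5) by simp
    also have "lam (C - V) + lam (C \<inter> K) = lam ((C - V) \<union> (C \<inter> K))"
      using CV CK V(3) by (intro additive[symmetric]) auto
    finally have "lam C - lam ((C - V) \<union> (C \<inter> K)) < \<epsilon>" by simp
    moreover have "C - V \<in> below (topspace X - K)"
      using CV V(3) compactin_subset_topspace[OF C] by (auto simp: below_def)
    moreover have "C \<inter> K \<in> below K" using CK by (auto simp: below_def)
    ultimately show "\<exists>D\<in>approx (below (topspace X - K)). \<exists>E\<in>approx (below K).
        D \<subseteq> C \<and> E \<subseteq> C \<and> lam C - lam (D \<union> E) < \<epsilon>"
      using subset_approx[OF compact_ideal_below] by (intro bexI[of _ "C - V"] bexI[of _ "C \<inter> K"]) auto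
  qed (simp_all add: content_ideal_approx_below)
  then show "content_proj X lam (topspace X - K) \<squnion>\<^bsub>CL\<^esub> approx (below K) = \<top>\<^bsub>CL\<^esub>"
    using op by (simp add: content_proj_eq)
qed

lemma content_ideal_eq_sup_compacts:
  assumes U: "content_ideal X lam U"
  shows "U = \<Squnion>\<^bsub>CL\<^esub>((\<lambda>K. approx (below K)) ` U)"
proof (rule C.sup_eqI[symmetric])
  show "V \<sqsubseteq>\<^bsub>CL\<^esub> U" if "V \<in> (\<lambda>K. approx (below K)) ` U" for V
  proof -
    obtain K where "K \<in> U" "V = approx (below K)" using \<open>V \<in> _\<close> by blast
    moreover from this have "below K \<subseteq> U"
      using content_ideal_down[OF U] by (auto simp: below_def)
    ultimately show ?thesis using approx_least[OF U] by auto
  qed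
  fix Y assume Y: "Y \<in> carrier CL" "\<And>V. V \<in> (\<lambda>K. approx (below K)) ` U \<Longrightarrow> V \<sqsubseteq>\<^bsub>CL\<^esub> Y"
  have "K \<in> Y" if "K \<in> U" for K
  proof -
    have "K \<in> below K" using content_ideal_subset[OF U] that by (auto simp: below_def compacts_def)
    then show ?thesis using Y(2)[of "approx (below K)"] subset_approx[OF compact_ideal_below[of K]] that by auto
  qed
  then show "U \<sqsubseteq>\<^bsub>CL\<^esub> Y" by auto
qed (use U in \<open>auto simp: content_ideal_approx_below\<close>)

lemma content_lift_eq: "content_lift X lam = B.ext_lift"
  unfolding content_lift_def
  by (rule B.lift_can_eq_lift) (simp add: content_proj_def)

lemma content_lift_open_compl:
  assumes K: "compactin X K"
  shows "content_lift X lam (open_sublocale (opens_frame X) (topspace X - K)) = approx (below K)"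
proof -
  have op: "topspace X - K \<in> carrier (opens_frame X)" using compact_closed[OF K] by auto
  have "B.ext_lift (can (opens_frame X) U) = content_proj X lam U" if "U \<in> carrier (opens_frame X)" for U
    using that by (simp add: B.lift_can_map B.A.is_sublocale_can)
  then show ?thesis
    using B.open_hom_eq_neg[OF B.frame_hom_lift _ op] K
    by (simp add: content_lift_eq compact_complement del: opens_frame_simps)
qed

text \<open>For surjectivity, a \<open>\<lambda>\<close>-ideal is the join of the \<open>\<lambda>\<close>-ideals generated by its members \<open>K\<close>, which are the values
of the lift at the open sublocales given by \<open>X - K\<close>; the lift preserves joins.\<close>

lemma locale_embedding_content_lift:
  "locale_embedding CL (sublocale_locale (opens_frame X)) (content_lift X lam)"
  unfolding locale_embedding_def
proof
  let ?Sl = "sublocale_locale (opens_frame X)"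
  have hom: "frame_hom ?Sl CL (content_lift X lam)"
    unfolding content_lift_eq by (rule B.frame_hom_lift)
  then show "content_lift X lam \<in> locale_maps CL ?Sl"
    by (simp add: locale_maps_def content_lift_eq)
  interpret h: frame_hom ?Sl CL "content_lift X lam" by (rule hom)
  show "content_lift X lam ` carrier ?Sl = carrier CL"
  proof
    show "content_lift X lam ` carrier ?Sl \<subseteq> carrier CL" using h.hom_closed by blast
    show "carrier CL \<subseteq> content_lift X lam ` carrier ?Sl"
    proof
      fix U assume "U \<in> carrier CL"
      then have U: "content_ideal X lam U" by simp
      let ?o = "\<lambda>K. open_sublocale (opens_frame X) (topspace X - K)"
      have comp: "compactin X K" if "K \<in> U" for K
        using content_ideal_subset[OF U] that by (auto simp: compacts_def)
      have "is_sublocale (opens_frame X) (?o K)" if K: "K \<in> U" for K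
        using compact_closed[OF comp[OF K]] by (intro B.A.is_sublocale_open) auto
      then have o: "?o ` U \<subseteq> carrier ?Sl" by auto
      have "U = \<Squnion>\<^bsub>CL\<^esub>((\<lambda>K. approx (below K)) ` U)"
        using U by (rule content_ideal_eq_sup_compacts)
      also have "(\<lambda>K. approx (below K)) ` U = content_lift X lam ` ?o ` U"
        unfolding image_image using comp by (intro image_cong) (auto simp: content_lift_open_compl)
      also have "\<Squnion>\<^bsub>CL\<^esub>\<dots> = content_lift X lam (\<Squnion>\<^bsub>?Sl\<^esub>(?o ` U))"
        using o by (rule h.hom_sup[symmetric])
      finally show "U \<in> content_lift X lam ` carrier ?Sl"
        using o by (metis B.A.Sl.weak.sup_closed image_eqI)
    qed
  qed
qed

end

theorem theorem1p12:
  fixes X :: "'a topology" and lam :: "'a set \<Rightarrow> real"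
  assumes "Hausdorff_space X" and "regular_content X lam"
  shows "locale_embedding (content_locale X lam) (sublocale_locale (opens_frame X))
           (content_lift X lam)"
proof -
  interpret hausdorff_content X lam
    using assms by (intro hausdorff_content.intro hausdorff_content_axioms.intro)
  show ?thesis by (rule locale_embedding_content_lift)
qed

end
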